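(* Let $d\ge1$, $\kappa>0$, $\rho>1$, $\frac1\rho+\frac1{\rho'}=1$, and let $0<\gamma<\gamma_2:=\frac{\rho'}{\rho}2^{1/\rho'}$. Let $v=\{v(x):x\in\mathbb Z^d\}$ be i.i.d. under $\mu$ with $\mu(v(0)>y)=\exp\{-y^\rho/\rho\}$, $y\ge0$. Let $L(t)\ge 1$ be an increasing function and let $\tau(t):=\left(\frac{d\rho'}{\gamma}\log L(t)\right)^{1/\rho'}$. Let $M:=\min\{j\ge1: 2j\rho'>2(j+1)\}$ and $\mathcal A_0:=\left(\frac{\gamma\rho}{\rho'}\right)^{1/\rho}$, and let $B_N$, $\mathcal B_N$, $\zeta_N$ be as defined in the context. Then: (i) There exists a unique function $h:[t_0,\infty)\to[0,\infty)$, where $t_0$ is defined by $\frac1{L(t_0)^d}=e^{-\frac1\rho\mathcal B_M^\rho}$, which satisfies $$\zeta_M(h(t))=\frac{1}{L(t)^d}.$$ (ii) The solution $h(t)$ of part (i) admits the expansion $$h(t)=\mathcal A_0\tau^{\rho'-1}(t)-2d\kappa+\sum_{1\le j\le M}h_j(t)+O\left(\frac{1}{t^{(2M+1)\frac{\rho'}{\rho}}}\right),$$ where the functions $h_j(t)$ are defined recursively by $h_0(t):=\mathcal A_0\tau^{\rho'-1}(t)-2d\kappa$ and, for $1\le j\le M$, $$h_j(t):=\frac1{\mathcal A_0^{\rho-1}}\left(\frac{\gamma}{\rho'}\tau^{\rho'-1}(t)+\frac1{\tau(t)}\log E_\mu\left[e^{-\frac1\rho B_j(h_0(t)+\cdots+h_{j-1}(t),v)^\rho}\right]\right),$$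 and they satisfy, for $1\le j\le M$, $$h_j(t)=O\left(\frac{1}{t^{(2j-1)\frac{\rho'}{\rho}}}\right).$$
   Context: A path in $\mathbb Z^d$ is a sequence $\gamma=\{z_1,\dots,z_p\}$ of sites with $z_j,z_{j+1}$ nearest neighbours for $1\le j\le p-1$; its length is the number $p$ of sites. $\mathbb P^n(0,0)$ is the set of paths of length $n$ with first and last site equal to $0$. Given $v$, put $v_0(z):=v(z)$ for $z\ne0$ and $v_0(0):=0$. For a natural number $N$ and $s\ge0$, $$B_N(s,v):=\frac{s+2d\kappa}{1+\sum_{j=1}^N\sum_{\gamma\in\mathbb P^{2j+1}(0,0)}\prod_{z\in\gamma,\,z\ne z_1}\frac{\kappa}{2d\kappa+(s-v_0(z))_+}},$$ where $(\cdot)_+$ is the positive part and the product runs over the $2j$ entries $z_2,\dots,z_{2j+1}$ of the path (all positions except the first). Further, $$\mathcal B_N:=\frac{2d\kappa}{1+\sum_{j=1}^N\sum_{\gamma\in\mathbb P^{2j+1}(0,0)}\left(\frac1{2d}\right)^{2j}},\qquad \zeta_N(s):=E_\mu\left[e^{-\frac1\rho B_N(s,v)^\rho}\right],\quad s\ge0.$$ $E_\mu$ is expectation under $\mu$. $O(s)$ denotes a quantity bounded in absolute value by $Cs$ with a non-random constant $C$ independent of $t$. (The path variable $\gamma$ in sums is unrelated to the number $\gamma$.)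
   Formalization: The error terms O(1/t^…) fail for general L (e.g. L(t)=1+t, where h_1 has order τ(t)^{-ρ'/ρ}); they are proved with τ(t) in place of t, and as printed in t (t>0) under the added condition t=O(τ(t)) on [t_0,∞). *)

theory Defs
  imports "HOL-Probability.Probability"
begin

text \<open>The lattice is \<open>int ^ 'd\<close>, of dimension \<open>CARD('d)\<close>.\<close>

definition nearest_neighbours :: "int ^ 'd \<Rightarrow> int ^ 'd \<Rightarrow> bool" where
  "nearest_neighbours x y \<longleftrightarrow> (\<Sum>i\<in>UNIV. \<bar>x $ i - y $ i\<bar>) = 1"

text \<open>The length of a path is its number of sites, not its number of steps.\<close>

definition paths :: "nat \<Rightarrow> int ^ 'd \<Rightarrow> int ^ 'd \<Rightarrow> (int ^ 'd) list set" where
  "paths n x y = {g. g \<noteq> [] \<and> length g = n \<and> successively nearest_neighbours g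
                    \<and> hd g = x \<and> last g = y}"

lemma finite_nearest_neighbours: "finite {y :: int ^ 'd. nearest_neighbours x y}"
proof -
  let ?P = "PiE UNIV (\<lambda>i::'d. {x $ i - 1..x $ i + 1})"
  have "{y. nearest_neighbours x y} \<subseteq> vec_lambda ` ?P"
  proof
    fix y :: "int ^ 'd"
    assume "y \<in> {y. nearest_neighbours x y}"
    then have s: "(\<Sum>i\<in>UNIV. \<bar>x $ i - y $ i\<bar>) = 1"
      by (simp add: nearest_neighbours_def)
    have "\<bar>x $ i - y $ i\<bar> \<le> 1" for i
      using member_le_sum[of i UNIV "\<lambda>i. \<bar>x $ i - y $ i\<bar>"] s by simp
    then have "vec_nth y \<in> ?P"
      by (simp add: PiE_iff abs_le_iff) (smt (verit))
    moreover have "y = vec_lambda (vec_nth y)"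
      by simp
    ultimately show "y \<in> vec_lambda ` ?P"
      by blast
  qed
  moreover have "finite ?P"
    by (intro finite_PiE) auto
  ultimately show ?thesis
    using finite_surj by blast
qed

text \<open>So the sums over \<^const>\<open>paths\<close> below are genuine finite sums.\<close>

lemma finite_paths: "finite (paths n x y)"
proof -
  have "finite {g. g \<noteq> [] \<and> length g = n \<and> successively nearest_neighbours g \<and> hd g = x}"
    (is "finite (?S n x)")
  proof (induction n arbitrary: x)
    case 0
    then show ?case by simp
  next
    case (Suc n)
    have "?S (Suc n) x \<subseteq> insert [x] ((#) x ` (\<Union>z\<in>{z. nearest_neighbours x z}. ?S n z))"
    proof
      fix g assume g: "g \<in> ?S (Suc n) x"
      then obtain g' where g': "g = x # g'"
        by (cases g) auto
      show "g \<in> insert [x] ((#) x ` (\<Union>z\<in>{z. nearest_neighbours x z}. ?S n z))"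
        using g g' by (cases g') auto
    qed
    moreover have "finite (insert [x] ((#) x ` (\<Union>z\<in>{z. nearest_neighbours x z}. ?S n z)))"
      using Suc.IH finite_nearest_neighbours by blast
    ultimately show ?case
      by (rule finite_subset)
  qed
  then show ?thesis
    by (rule finite_subset[rotated]) (auto simp: paths_def)
qed

definition zero_at_origin :: "(int ^ 'd \<Rightarrow> real) \<Rightarrow> int ^ 'd \<Rightarrow> real" where
  "zero_at_origin v z = (if z = 0 then 0 else v z)"

definition B_fun :: "real \<Rightarrow> nat \<Rightarrow> real \<Rightarrow> (int ^ 'd \<Rightarrow> real) \<Rightarrow> real" where
  "B_fun \<kappa> N s v =
     (s + 2 * real CARD('d) * \<kappa>) /
     (1 + (\<Sum>j=1..N. \<Sum>g\<in>paths (2 * j + 1) (0 :: int ^ 'd) 0.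
             \<Prod>z\<leftarrow>tl g. \<kappa> / (2 * real CARD('d) * \<kappa> + max 0 (s - zero_at_origin v z))))"

definition B_const :: "'d::finite itself \<Rightarrow> real \<Rightarrow> nat \<Rightarrow> real" where
  "B_const _ \<kappa> N =
     2 * real CARD('d) * \<kappa> /
     (1 + (\<Sum>j=1..N. \<Sum>g\<in>paths (2 * j + 1) (0 :: int ^ 'd) 0. (1 / (2 * real CARD('d))) ^ (2 * j)))"

text \<open>Random fields are maps \<open>v\<close> from sites to random variables on \<open>\<mu>\<close>.\<close>

definition zeta :: "'w measure \<Rightarrow> (int ^ 'd \<Rightarrow> 'w \<Rightarrow> real) \<Rightarrow> real \<Rightarrow> real \<Rightarrow> nat \<Rightarrow> real \<Rightarrow> real" where
  "zeta \<mu> v \<kappa> \<rho> N s = (\<integral>w. exp (- (1 / \<rho>) * B_fun \<kappa> N s (\<lambda>x. v x w) powr \<rho>) \<partial>\<mu>)"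

definition M_index :: "real \<Rightarrow> nat" where
  "M_index \<rho>' = (LEAST j. 1 \<le> j \<and> 2 * real j * \<rho>' > 2 * (real j + 1))"

definition A_zero :: "real \<Rightarrow> real \<Rightarrow> real \<Rightarrow> real" where
  "A_zero \<rho> \<rho>' \<gamma> = (\<gamma> * \<rho> / \<rho>') powr (1 / \<rho>)"

definition tau :: "nat \<Rightarrow> real \<Rightarrow> real \<Rightarrow> (real \<Rightarrow> real) \<Rightarrow> real \<Rightarrow> real" where
  "tau d \<rho>' \<gamma> L t = (real d * \<rho>' / \<gamma> * ln (L t)) powr (1 / \<rho>')"

fun h_term :: "'w measure \<Rightarrow> (int ^ 'd \<Rightarrow> 'w \<Rightarrow> real) \<Rightarrow> real \<Rightarrow> real \<Rightarrow> real \<Rightarrow> real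
    \<Rightarrow> (real \<Rightarrow> real) \<Rightarrow> nat \<Rightarrow> real \<Rightarrow> real" where
  "h_term \<mu> v \<kappa> \<rho> \<rho>' \<gamma> L 0 t =
     A_zero \<rho> \<rho>' \<gamma> * tau CARD('d) \<rho>' \<gamma> L t powr (\<rho>' - 1) - 2 * real CARD('d) * \<kappa>"
| "h_term \<mu> v \<kappa> \<rho> \<rho>' \<gamma> L (Suc j) t =
     1 / A_zero \<rho> \<rho>' \<gamma> powr (\<rho> - 1) *
     (\<gamma> / \<rho>' * tau CARD('d) \<rho>' \<gamma> L t powr (\<rho>' - 1) +
      1 / tau CARD('d) \<rho>' \<gamma> L t *
        ln (zeta \<mu> v \<kappa> \<rho> (Suc j) (\<Sum>i=0..j. h_term \<mu> v \<kappa> \<rho> \<rho>' \<gamma> L i t)))"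

text \<open>The constant is uniform over all of \<open>T\<close>, not only eventually.\<close>

definition O_on :: "real set \<Rightarrow> (real \<Rightarrow> real) \<Rightarrow> (real \<Rightarrow> real) \<Rightarrow> bool" where
  "O_on T f g \<longleftrightarrow> (\<exists>C. \<forall>t\<in>T. \<bar>f t\<bar> \<le> C * g t)"

text \<open>Membership in \<^const>\<open>PiE\<close> makes uniqueness of a function on \<open>{t0..}\<close> meaningful:
  values off that interval are fixed.\<close>

definition level_solution :: "'w measure \<Rightarrow> (int ^ 'd \<Rightarrow> 'w \<Rightarrow> real) \<Rightarrow> real \<Rightarrow> real \<Rightarrow> real
    \<Rightarrow> (real \<Rightarrow> real) \<Rightarrow> real \<Rightarrow> (real \<Rightarrow> real) \<Rightarrow> bool" where
  "level_solution \<mu> v \<kappa> \<rho> \<rho>' L t0 h \<longleftrightarrow>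
     h \<in> {t0..} \<rightarrow>\<^sub>E {0..} \<and>
     (\<forall>t\<ge>t0. zeta \<mu> v \<kappa> \<rho> (M_index \<rho>') (h t) = 1 / L t ^ CARD('d))"

end

theory Submission
  imports Defs "HOL-Real_Asymp.Real_Asymp"
begin

text \<open>Write \<open>D = 2d\<kappa>\<close>, \<open>S\<^sub>N(s,v)\<close> for the sum over return paths in the denominator of
\<open>B\<^sub>N\<close> (\<open>return_sum\<close>), \<open>f\<^sub>N = B\<^sub>N\<^sup>\<rho> / \<rho>\<close> (\<open>energy\<close>) and \<open>F\<^sub>N(s) = - log E[exp(- f\<^sub>N(s,v))] = - log \<zeta>\<^sub>N(s)\<close>
(\<open>free_energy\<close>).

Existence and uniqueness of \<open>h\<close> are soft. For every potential, \<open>S\<^sub>N\<close> is nonincreasing and continuous in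
\<open>s \<ge> 0\<close> and bounded by the number of paths, so \<open>B\<^sub>N\<close> is continuous, strictly increasing and unbounded. Hence
\<open>\<zeta>\<^sub>N\<close> decreases strictly and continuously to \<open>0\<close>; its value at \<open>s = 0\<close> is the one that defines
\<open>t\<^sub>0\<close>, because \<open>v > 0\<close> almost surely makes every weight equal to \<open>1/(2d)\<close> there.

For the expansion, use the parameter \<open>x = A\<^sub>0 \<tau>\<^bsup>\<rho>'-1\<^esup>\<close>. Then \<open>log L\<^sup>d = x\<^sup>\<rho> / \<rho>\<close>, and
\<open>A\<^sub>0\<^bsup>\<rho>-1\<^esup> \<tau> = x\<^bsup>\<rho>-1\<^esup>\<close> is the derivative of \<open>x\<^sup>\<rho> / \<rho>\<close>. The equation for \<open>h\<close> becomes
\<open>F\<^sub>M(h) = x\<^sup>\<rho> / \<rho>\<close>, and the partial sums \<open>s\<^sub>j = h\<^sub>0 + ... + h\<^sub>j\<close> become the iterates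
\<open>s\<^sub>0 = x - D\<close>, \<open>s\<^bsub>j+1\<^esub> = s\<^sub>j + (x\<^sup>\<rho> / \<rho> - F\<^bsub>j+1\<^esub>(s\<^sub>j)) / x\<^bsup>\<rho>-1\<^esup>\<close> of a Newton scheme with frozen slope, in
which step \<open>j\<close> also lengthens the paths by two steps (\<open>chord_iterate\<close>). As \<open>\<rho>'/\<rho> = \<rho>' - 1\<close>, the claimed
orders are simply \<open>x\<^bsup>-(2j-1)\<^esup>\<close> and \<open>x\<^bsup>-(2M+1)\<^esup>\<close>.

Two estimates, valid for \<open>s + D = x + O(1/x)\<close>, carry the expansion.

 \<^item> \<open>F\<^sub>N(s') - F\<^sub>N(s) = (s' - s) x\<^bsup>\<rho>-1\<^esup> (1 + O(x\<^bsup>-2\<^esup>))\<close> up to an error smaller than any power of \<open>1/x\<close>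
   (\<open>free_energy_increment\<close>): the frozen slope is correct to relative order \<open>x\<^bsup>-2\<^esup>\<close>.
 \<^item> \<open>F\<^sub>N(s) - F\<^bsub>N+1\<^esub>(s) = O(x\<^bsup>\<rho>-1\<^esup> x\<^bsup>-(2N+1)\<^esup>)\<close> (\<open>free_energy_Suc_diff\<close>): the new paths have
   \<open>2N + 2\<close> steps.

They give \<open>x\<^sup>\<rho> / \<rho> - F\<^sub>j(s\<^sub>j) = O(x\<^bsup>\<rho>-1\<^esup> x\<^bsup>-(2j+1)\<^esup>)\<close> by induction on \<open>j\<close> (\<open>chord_iterate_residual\<close>):
changing \<open>F\<^sub>j\<close> to \<open>F\<^bsub>j+1\<^esub>\<close> does not change the order of the residual, the step
\<open>h\<^bsub>j+1\<^esub>\<close> is therefore \<open>O(x\<^bsup>-(2j+1)\<^esup>)\<close>, and the slope error improves the residual by the factor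
\<open>x\<^bsup>-2\<^esup>\<close>. Since \<open>F\<^sub>M\<close> is increasing with slope about \<open>x\<^bsup>\<rho>-1\<^esup>\<close>, its level \<open>x\<^sup>\<rho> / \<rho>\<close> is attained within
\<open>O(x\<^bsup>-(2M+1)\<^esup>)\<close> of \<open>s\<^sub>M\<close> (\<open>level_near_iterate_eventually\<close>). On bounded ranges of \<open>x\<close> everything is
bounded, which makes the constants uniform on all of \<open>[t\<^sub>0, \<infinity>)\<close>.

Both estimates hold pointwise for potentials that are at most \<open>x/4\<close> on the finitely many sites visited
(\<open>energy_increment\<close>, \<open>energy_Suc_diff\<close>), since every weight is then at most \<open>4\<kappa>/x\<close>. The other potentials do
not matter (\<open>not_calm_negligible\<close>): each path ends at the origin, where the weight is
\<open>\<kappa>/(s + D)\<close>, so \<open>S\<^sub>N = O(1/x)\<close> for every potential and a large \<open>v\<close> can lower \<open>f\<^sub>N\<close> by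
at most \<open>O(x\<^bsup>\<rho>-1\<^esup>)\<close>, whereas such a \<open>v\<close> has probability \<open>exp(- c x\<^sup>\<rho>)\<close>.
\<close>

section \<open>Real powers and uniform bounds\<close>

lemma powr_lipschitz_near_one:
  fixes a :: real
  shows "\<exists>C\<ge>0. \<forall>y\<in>{1/2..2}. \<bar>y powr a - 1\<bar> \<le> C * \<bar>y - 1\<bar>"
proof (intro exI conjI ballI)
  let ?C = "\<bar>a\<bar> * 2 powr \<bar>a - 1\<bar>"
  show "0 \<le> ?C" by simp
  fix y :: real assume y: "y \<in> {1/2..2}"
  have "\<bar>a * z powr (a - 1)\<bar> \<le> ?C" if z: "z \<in> {1/2..2}" for z :: real
  proof -
    have "ln (1/2) \<le> ln z" "ln z \<le> ln 2"
      using z by (auto)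
    then have "\<bar>ln z\<bar> \<le> ln 2"
      by (simp add: ln_div)
    then have "\<bar>a - 1\<bar> * \<bar>ln z\<bar> \<le> \<bar>a - 1\<bar> * ln 2"
      by (intro mult_left_mono) auto
    then have "(a - 1) * ln z \<le> \<bar>a - 1\<bar> * ln 2"
      using abs_ge_self[of "(a - 1) * ln z"] by (simp only: abs_mult)
    then have "z powr (a - 1) \<le> 2 powr \<bar>a - 1\<bar>"
      using z by (simp add: powr_def)
    then show ?thesis
      by (auto simp: abs_mult intro!: mult_left_mono)
  qed
  then have "norm (y powr a - 1 powr a) \<le> ?C * norm (y - 1)"
    using y
    by (intro field_differentiable_bound[where S = "{1/2..2}"
          and f' = "\<lambda>z. a * z powr (a - 1)"] DERIV_subset[OF has_real_derivative_powr]) auto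
  then show "\<bar>y powr a - 1\<bar> \<le> ?C * \<bar>y - 1\<bar>"
    by simp
qed

text \<open>The mean value theorem for \<open>z \<mapsto> z\<^sup>\<rho> / \<rho> - z x\<^bsup>\<rho>-1\<^esup>\<close>, whose derivative is of relative order
  \<open>x\<^bsup>-2\<^esup>\<close> on \<open>[x - K/x, x + K/x]\<close>: this width of the interval is what makes the frozen slope accurate.\<close>

lemma powr_increment_near:
  fixes \<rho> K :: real
  assumes "\<rho> > 1"
  shows "\<exists>C\<ge>0. \<forall>\<^sub>F x in at_top. \<forall>b c. \<bar>b - x\<bar> \<le> K / x \<longrightarrow> \<bar>c - x\<bar> \<le> K / x \<longrightarrow>
     \<bar>c powr \<rho> / \<rho> - b powr \<rho> / \<rho> - (c - b) * x powr (\<rho> - 1)\<bar>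
       \<le> C * \<bar>c - b\<bar> * (x powr (\<rho> - 1) / x\<^sup>2)"
proof -
  obtain C where C: "C \<ge> 0" "\<And>y. y \<in> {1/2..2} \<Longrightarrow> \<bar>y powr (\<rho> - 1) - 1\<bar> \<le> C * \<bar>y - 1\<bar>"
    using powr_lipschitz_near_one by blast
  have "\<bar>c powr \<rho> / \<rho> - b powr \<rho> / \<rho> - (c - b) * x powr (\<rho> - 1)\<bar>
       \<le> (C * max K 0) * \<bar>c - b\<bar> * (x powr (\<rho> - 1) / x\<^sup>2)"
    if x: "1 \<le> x" "2 * K \<le> x" and b: "\<bar>b - x\<bar> \<le> K / x" and c: "\<bar>c - x\<bar> \<le> K / x" for x b c
  proof -
    define S where "S = {x - K / x..x + K / x}"
    have near: "K / x \<le> x / 2"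
    proof -
      have "x * 1 \<le> x * x" using x by (intro mult_left_mono) auto
      then have "K * 2 \<le> x * x" using x by linarith
      then show ?thesis using x by (simp add: field_simps)
    qed
    have deriv: "\<bar>z powr (\<rho> - 1) - x powr (\<rho> - 1)\<bar> \<le> C * max K 0 * (x powr (\<rho> - 1) / x\<^sup>2)"
      if "z \<in> S" for z
    proof -
      have z: "\<bar>z - x\<bar> \<le> K / x" using that by (auto simp: S_def)
      have zr: "z / x \<in> {1/2..2}"
        proof -
        have "x / 2 \<le> z" "z \<le> 2 * x" using z near x by linarith+
        then show ?thesis using x by (simp add: field_simps)
      qed
      have "\<bar>(z / x) powr (\<rho> - 1) - 1\<bar> \<le> C * \<bar>z / x - 1\<bar>"
        by (rule C(2)[OF zr])
      also have "\<bar>z / x - 1\<bar> = \<bar>z - x\<bar> / x"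
        using x by (simp add: field_simps abs_if)
      also have "C * (\<bar>z - x\<bar> / x) \<le> C * (max K 0 / x / x)"
      proof (intro mult_left_mono divide_right_mono)
        have "K / x \<le> max K 0 / x" using x by (intro divide_right_mono) auto
        then show "\<bar>z - x\<bar> \<le> max K 0 / x" using z by linarith
      qed (use x C(1) in auto)
      finally have "\<bar>(z / x) powr (\<rho> - 1) - 1\<bar> \<le> C * max K 0 / x\<^sup>2"
        by (simp add: power2_eq_square)
      then have "x powr (\<rho> - 1) * \<bar>(z / x) powr (\<rho> - 1) - 1\<bar> \<le> x powr (\<rho> - 1) * (C * max K 0 / x\<^sup>2)"
        by (intro mult_left_mono) auto
      moreover have "x powr (\<rho> - 1) * \<bar>(z / x) powr (\<rho> - 1) - 1\<bar> = \<bar>z powr (\<rho> - 1) - x powr (\<rho> - 1)\<bar>"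
        using zr x by (simp add: powr_divide field_simps flip: abs_mult_pos)
      ultimately show ?thesis by (simp add: mult_ac)
    qed
    have "norm ((c powr \<rho> / \<rho> - c * x powr (\<rho> - 1)) - (b powr \<rho> / \<rho> - b * x powr (\<rho> - 1)))
        \<le> C * max K 0 * (x powr (\<rho> - 1) / x\<^sup>2) * norm (c - b)"
    proof (rule field_differentiable_bound[where S = S and f' = "\<lambda>z. z powr (\<rho> - 1) - x powr (\<rho> - 1)"
           and f = "\<lambda>z. z powr \<rho> / \<rho> - z * x powr (\<rho> - 1)"])
      show "convex S" by (simp add: S_def)
      show "c \<in> S" "b \<in> S" using b c by (auto simp: S_def)
      fix z assume z: "z \<in> S"
      then have "z > 0" using near x by (auto simp: S_def)
      then show "((\<lambda>z. z powr \<rho> / \<rho> - z * x powr (\<rho> - 1)) has_field_derivative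
           z powr (\<rho> - 1) - x powr (\<rho> - 1)) (at z within S)"
        using assms by (auto intro!: derivative_eq_intros DERIV_subset[OF has_real_derivative_powr])
      show "norm (z powr (\<rho> - 1) - x powr (\<rho> - 1)) \<le> C * max K 0 * (x powr (\<rho> - 1) / x\<^sup>2)"
        using deriv[OF z] by simp
    qed
    then show ?thesis
      by (simp add: algebra_simps)
  qed
  note bound = this
  have "\<forall>\<^sub>F x in at_top. \<forall>b c. \<bar>b - x\<bar> \<le> K / x \<longrightarrow> \<bar>c - x\<bar> \<le> K / x \<longrightarrow>
     \<bar>c powr \<rho> / \<rho> - b powr \<rho> / \<rho> - (c - b) * x powr (\<rho> - 1)\<bar>
       \<le> C * max K 0 * \<bar>c - b\<bar> * (x powr (\<rho> - 1) / x\<^sup>2)"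
    using eventually_ge_at_top[of 1] eventually_ge_at_top[of "2 * K"]
    by eventually_elim (use bound in blast)
  then show ?thesis
    using C(1) by (intro exI[of _ "C * max K 0"]) auto
qed

lemma powr_increment_le:
  fixes a b \<rho> :: real
  assumes "0 < b" "b \<le> a" "\<rho> > 1"
  shows "a powr \<rho> / \<rho> - b powr \<rho> / \<rho> \<le> (a - b) * a powr (\<rho> - 1)"
proof (cases "a = b")
  case False
  then have "b < a" using assms by simp
  have "\<exists>z>b. z < a \<and> a powr \<rho> / \<rho> - b powr \<rho> / \<rho> = (a - b) * z powr (\<rho> - 1)"
  proof (rule MVT2[OF \<open>b < a\<close>])
    fix x assume "b \<le> x" "x \<le> a"
    then have "((\<lambda>z. z powr \<rho> / \<rho>) has_real_derivative \<rho> * x powr (\<rho> - 1) / \<rho>) (at x)"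
      using assms by (intro DERIV_cdivide has_real_derivative_powr) auto
    then show "((\<lambda>z. z powr \<rho> / \<rho>) has_real_derivative x powr (\<rho> - 1)) (at x)"
      using assms by simp
  qed
  then obtain z where z: "b < z" "z < a" "a powr \<rho> / \<rho> - b powr \<rho> / \<rho> = (a - b) * z powr (\<rho> - 1)"
    by blast
  have "z powr (\<rho> - 1) \<le> a powr (\<rho> - 1)" using z assms by (intro powr_mono2) auto
  then show ?thesis unfolding z(3) using assms by (intro mult_left_mono) auto
qed simp

text \<open>The convex function \<open>w \<mapsto> (1 + w)\<^sup>n\<close> lies below its chord over \<open>[0, 1]\<close>.\<close>

lemma one_plus_power_le:
  fixes w :: real
  assumes "0 \<le> w" "w \<le> 1"
  shows "(1 + w) ^ n \<le> 1 + 2 ^ n * w"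
proof -
  \<comment> \<open>the chord itself: the weaker bound of the lemma is not preserved by the induction step\<close>
  have "(1 + w) ^ n \<le> 1 + (2 ^ n - 1) * w"
  proof (induction n)
    case (Suc n)
    have "(1 + w) ^ Suc n \<le> (1 + w) * (1 + (2 ^ n - 1) * w)"
      using Suc assms by (auto intro!: mult_left_mono)
    also have "\<dots> = 1 + w + (2 ^ n - 1) * w + (2 ^ n - 1) * (w * w)"
      by (simp add: algebra_simps)
    also have "\<dots> \<le> 1 + w + (2 ^ n - 1) * w + (2 ^ n - 1) * (w * 1)"
      using assms by (intro add_left_mono mult_left_mono) auto
    finally show ?case by (simp add: algebra_simps)
  qed simp
  then show ?thesis using assms by (simp add: algebra_simps)
qed

text \<open>The exponent \<open>\<rho>\<close> of the tail of the potential beats the exponent \<open>\<rho> - 1\<close> of what a large potential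
  can gain in the exponential moment.\<close>

lemma atypical_weight_negligible:
  fixes \<rho> A c :: real and m :: nat
  assumes "\<rho> > 1" 
  shows "\<forall>\<^sub>F x in at_top. A * exp (c * (2 * x) powr (\<rho> - 1) - (x / 4) powr \<rho> / \<rho>) \<le> 1 / x ^ m"
proof -
  have "((\<lambda>x. A * exp (c * (2 * x) powr (\<rho> - 1) - (x / 4) powr \<rho> / \<rho>) * x ^ m) \<longlongrightarrow> 0) at_top"
    using assms by real_asymp
  then have "\<forall>\<^sub>F x in at_top. A * exp (c * (2 * x) powr (\<rho> - 1) - (x / 4) powr \<rho> / \<rho>) * x ^ m < 1"
    by (rule order_tendstoD) simp
  then show ?thesis
    using eventually_gt_at_top[of 0]
    by eventually_elim (simp add: field_simps)
qed

text \<open>Turns asymptotic bounds into bounds with one constant on all of \<open>[x0, \<infinity>)\<close>. The relation \<open>P\<close> allows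
  \<open>y\<close> to be any root of an equation that depends on \<open>x\<close>.\<close>

lemma bound_from_eventually:
  fixes P :: "real \<Rightarrow> real \<Rightarrow> bool" and x0 C :: real
  assumes x0: "x0 > 0"
    and large: "\<forall>\<^sub>F x in at_top. \<forall>y. P x y \<longrightarrow> \<bar>y\<bar> \<le> C / x ^ k"
    and bounded: "\<And>X. \<exists>K. \<forall>x\<in>{x0..X}. \<forall>y. P x y \<longrightarrow> \<bar>y\<bar> \<le> K"
  shows "\<exists>C. \<forall>x\<ge>x0. \<forall>y. P x y \<longrightarrow> \<bar>y\<bar> \<le> C / x ^ k"
proof -
  obtain X where X: "\<And>x y. x \<ge> X \<Longrightarrow> P x y \<Longrightarrow> \<bar>y\<bar> \<le> C / x ^ k"
    using large unfolding eventually_at_top_linorder by blast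
  obtain K where K: "\<And>x y. x0 \<le> x \<Longrightarrow> x \<le> X \<Longrightarrow> P x y \<Longrightarrow> \<bar>y\<bar> \<le> K"
    using bounded[of X] by (meson atLeastAtMost_iff)
  have "\<bar>y\<bar> \<le> max C (\<bar>K\<bar> * \<bar>X\<bar> ^ k) / x ^ k" if x: "x \<ge> x0" and P: "P x y" for x y
  proof (cases "x \<ge> X")
    case True
    have "\<bar>y\<bar> \<le> C / x ^ k" using X True P by blast
    also have "\<dots> \<le> max C (\<bar>K\<bar> * \<bar>X\<bar> ^ k) / x ^ k"
      using x x0 by (intro divide_right_mono) auto
    finally show ?thesis .
  next
    case False
    have "x ^ k > 0" using x x0 by simp
    have "\<bar>y\<bar> * x ^ k \<le> \<bar>K\<bar> * \<bar>X\<bar> ^ k"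
      using K[OF x _ P] False x x0 by (intro mult_mono power_mono) auto
    also have "\<dots> \<le> max C (\<bar>K\<bar> * \<bar>X\<bar> ^ k)" by simp
    finally show ?thesis using \<open>x ^ k > 0\<close> by (simp add: pos_le_divide_eq)
  qed
  then show ?thesis by blast
qed

text \<open>If \<open>t\<close> is of order at most \<open>g t\<close>, then decay in \<open>g t\<close> is decay in \<open>t\<close>.\<close>

lemma O_on_inverse_powr_comparison:
  assumes T: "O_on T (\<lambda>t. t) g" and f: "O_on T f (\<lambda>t. 1 / g t powr a)"
    and g: "\<And>t. t \<in> T \<Longrightarrow> g t > 0" and a: "a \<ge> 0"
  shows "O_on (T \<inter> {0<..}) f (\<lambda>t. 1 / t powr a)"
proof -
  obtain A where A: "\<And>t. t \<in> T \<Longrightarrow> \<bar>t\<bar> \<le> A * g t" using T by (auto simp: O_on_def)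
  obtain C where C: "\<And>t. t \<in> T \<Longrightarrow> \<bar>f t\<bar> \<le> C * (1 / g t powr a)" using f by (auto simp: O_on_def)
  have "\<bar>f t\<bar> \<le> \<bar>C\<bar> * \<bar>A\<bar> powr a * (1 / t powr a)" if t: "t \<in> T" "t > 0" for t
  proof -
    have "t \<le> \<bar>A\<bar> * g t" using A[OF t(1)] t(2) g[OF t(1)] by (smt (verit) mult_right_mono)
    then have "t powr a \<le> \<bar>A\<bar> powr a * g t powr a"
      using t g[OF t(1)] a powr_mono2[of a t "\<bar>A\<bar> * g t"] by (simp add: powr_mult)
    then have "1 / g t powr a \<le> \<bar>A\<bar> powr a * (1 / t powr a)"
      using t g[OF t(1)] by (simp add: field_simps)
    then have "\<bar>C\<bar> * (1 / g t powr a) \<le> \<bar>C\<bar> * (\<bar>A\<bar> powr a * (1 / t powr a))"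
      by (intro mult_left_mono) auto
    moreover have "C * (1 / g t powr a) \<le> \<bar>C\<bar> * (1 / g t powr a)"
      by (intro mult_right_mono) auto
    ultimately show ?thesis using C[OF t(1)] by simp
  qed
  then show ?thesis unfolding O_on_def by fastforce
qed

lemma prod_list_const:
  "(\<And>z. z \<in> set g \<Longrightarrow> f z = r) \<Longrightarrow> (\<Prod>z\<leftarrow>g. f z) = (r :: real) ^ length g"
  by (induction g) auto

section \<open>Sums over return paths\<close>

definition hop_weight :: "real \<Rightarrow> real \<Rightarrow> (int ^ 'd \<Rightarrow> real) \<Rightarrow> int ^ 'd \<Rightarrow> real" where
  "hop_weight \<kappa> s u z = \<kappa> / (2 * real CARD('d) * \<kappa> + max 0 (s - zero_at_origin u z))"

definition return_sum :: "real \<Rightarrow> nat \<Rightarrow> real \<Rightarrow> (int ^ 'd \<Rightarrow> real) \<Rightarrow> real" where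
  "return_sum \<kappa> N s u =
     (\<Sum>j=1..N. \<Sum>g\<in>paths (2 * j + 1) (0 :: int ^ 'd) 0. \<Prod>z\<leftarrow>tl g. hop_weight \<kappa> s u z)"

text \<open>The value of \<^term>\<open>return_sum\<close> when all weights equal \<open>1\<close>; as weights are at most \<open>1\<close>, it bounds the
  sum for every potential.\<close>

definition return_count :: "'d::finite itself \<Rightarrow> nat \<Rightarrow> nat" where
  "return_count _ N = (\<Sum>j=1..N. card (paths (2 * j + 1) (0 :: int ^ 'd) 0))"

text \<open>The starting point of a path counts as visited only through the return to it, since the first entry
  carries no weight.\<close>

definition return_sites :: "nat \<Rightarrow> (int ^ 'd) set" where
  "return_sites N = (\<Union>j\<in>{1..N}. \<Union>g\<in>paths (2 * j + 1) 0 0. set (tl g))"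

lemma finite_return_sites: "finite (return_sites N)"
  by (auto simp: return_sites_def finite_paths)

lemma B_fun_eq: "B_fun \<kappa> N s u = (s + 2 * real CARD('d) * \<kappa>) / (1 + return_sum \<kappa> N s u)"
  for u :: "int ^ 'd \<Rightarrow> real"
  by (simp add: B_fun_def return_sum_def hop_weight_def)

lemma path_tl:
  assumes "g \<in> paths (2 * j + 1) x y" "j \<ge> 1"
  shows "length (tl g) = 2 * j" "y \<in> set (tl g)"
proof -
  show l: "length (tl g) = 2 * j" using assms by (auto simp: paths_def)
  then have "tl g \<noteq> []" using assms(2) by (cases "tl g") auto
  then show "y \<in> set (tl g)" using assms by (cases g) (auto simp: paths_def)
qed

context
  fixes \<kappa> :: real
  assumes \<kappa>: "\<kappa> > 0"
begin

lemma hop_weight_pos: "hop_weight \<kappa> s u z > 0"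
  using \<kappa> by (auto simp: hop_weight_def intro!: divide_pos_pos add_pos_nonneg)

lemma hop_weight_le_1: "hop_weight \<kappa> s u z \<le> 1" for u :: "int ^ 'd \<Rightarrow> real"
proof -
  have "1 * \<kappa> \<le> (2 * real CARD('d)) * \<kappa>"
    using \<kappa> zero_less_card_finite[where 'a = 'd] by (intro mult_right_mono) linarith+
  then have "\<kappa> \<le> 2 * real CARD('d) * \<kappa> + max 0 (s - zero_at_origin u z)"
    by linarith
  then show ?thesis
    using \<kappa> by (simp add: hop_weight_def divide_le_eq)
qed

lemma hop_weight_antimono: "s \<le> s' \<Longrightarrow> hop_weight \<kappa> s' u z \<le> hop_weight \<kappa> s u z"
  using \<kappa> by (auto simp: hop_weight_def intro!: divide_left_mono mult_pos_pos add_pos_nonneg)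

text \<open>The reciprocal of \<^term>\<open>hop_weight \<kappa> s u z\<close> grows in \<open>s\<close> at rate at most \<open>1/\<kappa>\<close>. Expressing this as a ratio,
  rather than a difference, lets the bound multiply along a path.\<close>

lemma hop_weight_le_increment:
  fixes u :: "int ^ 'd \<Rightarrow> real"
  assumes "s \<le> s'" and r: "hop_weight \<kappa> s u z \<le> r"
  shows "hop_weight \<kappa> s u z \<le> hop_weight \<kappa> s' u z * (1 + (s' - s) * r / \<kappa>)"
proof -
  define a b where "a = 2 * real CARD('d) * \<kappa> + max 0 (s - zero_at_origin u z)"
    and "b = 2 * real CARD('d) * \<kappa> + max 0 (s' - zero_at_origin u z)"
  have ab: "a > 0" "b > 0" "b \<le> a + (s' - s)"
    using \<kappa> assms(1) by (auto simp: a_def b_def intro!: add_pos_nonneg)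
  have h: "hop_weight \<kappa> s u z = \<kappa> / a" "hop_weight \<kappa> s' u z = \<kappa> / b"
    by (simp_all add: hop_weight_def a_def b_def)
  have "b / a \<le> 1 + (s' - s) * (\<kappa> / a) / \<kappa>"
  proof -
    have "(s' - s) * (\<kappa> / a) / \<kappa> = (s' - s) / a" using \<kappa> by simp
    moreover have "b / a \<le> (a + (s' - s)) / a" using ab by (intro divide_right_mono) auto
    ultimately show ?thesis using ab by (simp add: add_divide_distrib)
  qed
  also have "\<dots> \<le> 1 + (s' - s) * r / \<kappa>"
    using r \<kappa> assms(1) unfolding h by (intro add_left_mono divide_right_mono mult_left_mono) auto
  finally have "\<kappa> / b * (b / a) \<le> \<kappa> / b * (1 + (s' - s) * r / \<kappa>)"
    using \<kappa> ab by (intro mult_left_mono) auto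
  then show ?thesis
    unfolding h using ab by simp
qed

lemma prod_hop_weight_nonneg: "(\<Prod>z\<leftarrow>g. hop_weight \<kappa> s u z) \<ge> 0"
  by (induction g) (auto intro: mult_nonneg_nonneg less_imp_le[OF hop_weight_pos])

lemma prod_hop_weight_le_power:
  assumes "\<And>z. z \<in> set g \<Longrightarrow> hop_weight \<kappa> s u z \<le> r"
  shows "(\<Prod>z\<leftarrow>g. hop_weight \<kappa> s u z) \<le> r ^ length g"
  using assms
proof (induction g)
  case (Cons a g)
  then have "0 \<le> r" using hop_weight_pos[of s u a] by (meson less_imp_le list.set_intros(1) order_trans)
  with Cons show ?case
    by (auto intro!: mult_mono prod_hop_weight_nonneg)
qed simp

lemma prod_hop_weight_le_single:
  assumes "y \<in> set g"
  shows "(\<Prod>z\<leftarrow>g. hop_weight \<kappa> s u z) \<le> hop_weight \<kappa> s u y"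
  using assms
proof (induction g)
  case (Cons a g)
  have le1: "(\<Prod>z\<leftarrow>g. hop_weight \<kappa> s u z) \<le> 1"
    using prod_hop_weight_le_power[of g s u 1] hop_weight_le_1 by auto
  show ?case
  proof (cases "y = a")
    case True
    then show ?thesis using le1 hop_weight_pos[of s u a] by (simp add: mult_left_le)
  next
    case False
    then have "(\<Prod>z\<leftarrow>g. hop_weight \<kappa> s u z) \<le> hop_weight \<kappa> s u y" using Cons by auto
    moreover have "hop_weight \<kappa> s u a * (\<Prod>z\<leftarrow>g. hop_weight \<kappa> s u z) \<le> (\<Prod>z\<leftarrow>g. hop_weight \<kappa> s u z)"
      by (intro mult_left_le_one_le prod_hop_weight_nonneg hop_weight_le_1 less_imp_le[OF hop_weight_pos])
    ultimately show ?thesis by simp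
  qed
qed simp

lemma prod_hop_weight_antimono:
  assumes "s \<le> s'"
  shows "(\<Prod>z\<leftarrow>g. hop_weight \<kappa> s' u z) \<le> (\<Prod>z\<leftarrow>g. hop_weight \<kappa> s u z)"
  by (induction g)
    (auto intro!: mult_mono hop_weight_antimono assms prod_hop_weight_nonneg less_imp_le[OF hop_weight_pos])

lemma prod_hop_weight_le_increment:
  assumes "s \<le> s'" "\<And>z. z \<in> set g \<Longrightarrow> hop_weight \<kappa> s u z \<le> r" "0 \<le> r"
  shows "(\<Prod>z\<leftarrow>g. hop_weight \<kappa> s u z)
    \<le> (\<Prod>z\<leftarrow>g. hop_weight \<kappa> s' u z) * (1 + (s' - s) * r / \<kappa>) ^ length g"
  using assms(2)
proof (induction g)
  case (Cons a g)
  let ?w = "1 + (s' - s) * r / \<kappa>"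
  have w: "?w \<ge> 0" using assms \<kappa> by simp
  have "hop_weight \<kappa> s u a * (\<Prod>z\<leftarrow>g. hop_weight \<kappa> s u z)
     \<le> (hop_weight \<kappa> s' u a * ?w) * ((\<Prod>z\<leftarrow>g. hop_weight \<kappa> s' u z) * ?w ^ length g)"
    using Cons w assms(1)
    by (intro mult_mono hop_weight_le_increment prod_hop_weight_nonneg mult_nonneg_nonneg
        less_imp_le[OF hop_weight_pos]) auto
  then show ?case by (simp add: mult_ac)
qed simp

lemma return_sum_nonneg: "return_sum \<kappa> N s u \<ge> 0"
  unfolding return_sum_def by (intro sum_nonneg prod_hop_weight_nonneg)

lemma return_sum_antimono: "s \<le> s' \<Longrightarrow> return_sum \<kappa> N s' u \<le> return_sum \<kappa> N s u"
  unfolding return_sum_def by (intro sum_mono prod_hop_weight_antimono)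

lemma return_sum_le:
  fixes u :: "int ^ 'd \<Rightarrow> real"
  assumes "\<And>j g. 1 \<le> j \<Longrightarrow> j \<le> N \<Longrightarrow> g \<in> paths (2 * j + 1) 0 0 \<Longrightarrow> (\<Prod>z\<leftarrow>tl g. hop_weight \<kappa> s u z) \<le> r"
  shows "return_sum \<kappa> N s u \<le> real (return_count TYPE('d) N) * r"
proof -
  have "return_sum \<kappa> N s u \<le> (\<Sum>j=1..N. \<Sum>g\<in>paths (2 * j + 1) (0 :: int ^ 'd) 0. r)"
    unfolding return_sum_def by (intro sum_mono assms) auto
  then show ?thesis by (simp add: return_count_def sum_distrib_right)
qed

lemma return_sum_le_count: "return_sum \<kappa> N s u \<le> real (return_count TYPE('d) N)"
    for u :: "int ^ 'd \<Rightarrow> real"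
proof -
  have "return_sum \<kappa> N s u \<le> real (return_count TYPE('d) N) * 1"
  proof (rule return_sum_le)
    fix g :: "(int ^ 'd) list"
    show "(\<Prod>z\<leftarrow>tl g. hop_weight \<kappa> s u z) \<le> 1"
      using prod_hop_weight_le_power[of "tl g" s u 1] hop_weight_le_1 by auto
  qed
  then show ?thesis by simp
qed

text \<open>Every path ends at the origin, where the potential is set to \<open>0\<close>. Bounding all other weights by \<open>1\<close>
  leaves a bound of order \<open>1/s\<close> that is uniform in the potential.\<close>

lemma return_sum_le_inverse:
  fixes u :: "int ^ 'd \<Rightarrow> real"
  assumes "s \<ge> 0"
  shows "return_sum \<kappa> N s u \<le> real (return_count TYPE('d) N) * (\<kappa> / (s + 2 * real CARD('d) * \<kappa>))"
proof (rule return_sum_le)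
  fix j and g :: "(int ^ 'd) list" assume j: "1 \<le> j" and g: "g \<in> paths (2 * j + 1) 0 0"
  have "hop_weight \<kappa> s u 0 = \<kappa> / (s + 2 * real CARD('d) * \<kappa>)"
    using assms by (simp add: hop_weight_def zero_at_origin_def add_ac)
  then show "(\<Prod>z\<leftarrow>tl g. hop_weight \<kappa> s u z) \<le> \<kappa> / (s + 2 * real CARD('d) * \<kappa>)"
    using prod_hop_weight_le_single[OF path_tl(2)[OF g j]] by metis
qed

text \<open>A return path has at least two steps.\<close>

lemma return_sum_le_square:
  fixes u :: "int ^ 'd \<Rightarrow> real"
  assumes "\<And>z. z \<in> return_sites N \<Longrightarrow> hop_weight \<kappa> s u z \<le> r" "0 \<le> r" "r \<le> 1"
  shows "return_sum \<kappa> N s u \<le> real (return_count TYPE('d) N) * r\<^sup>2"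
proof (rule return_sum_le)
  fix j and g :: "(int ^ 'd) list" assume j: "1 \<le> j" "j \<le> N" and g: "g \<in> paths (2 * j + 1) 0 0"
  have "(\<Prod>z\<leftarrow>tl g. hop_weight \<kappa> s u z) \<le> r ^ length (tl g)"
    using assms(1) j g by (intro prod_hop_weight_le_power) (force simp: return_sites_def)
  also have "\<dots> \<le> r ^ 2"
    using assms j path_tl(1)[OF g j(1)] by (intro power_decreasing) auto
  finally show "(\<Prod>z\<leftarrow>tl g. hop_weight \<kappa> s u z) \<le> r\<^sup>2" .
qed

lemma return_sum_Suc_diff:
  fixes u :: "int ^ 'd \<Rightarrow> real"
  assumes "\<And>z. z \<in> return_sites (Suc N) \<Longrightarrow> hop_weight \<kappa> s u z \<le> r"
  shows "return_sum \<kappa> N s u \<le> return_sum \<kappa> (Suc N) s u"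
    and "return_sum \<kappa> (Suc N) s u - return_sum \<kappa> N s u
      \<le> real (return_count TYPE('d) (Suc N)) * r ^ (2 * N + 2)"
proof -
  let ?P = "paths (2 * Suc N + 1) (0 :: int ^ 'd) 0"
  have eq: "return_sum \<kappa> (Suc N) s u - return_sum \<kappa> N s u = (\<Sum>g\<in>?P. \<Prod>z\<leftarrow>tl g. hop_weight \<kappa> s u z)"
    by (simp add: return_sum_def)
  then show "return_sum \<kappa> N s u \<le> return_sum \<kappa> (Suc N) s u"
    using sum_nonneg[of ?P] prod_hop_weight_nonneg by (smt (verit))
  have "(\<Sum>g\<in>?P. \<Prod>z\<leftarrow>tl g. hop_weight \<kappa> s u z) \<le> (\<Sum>g\<in>?P. r ^ (2 * N + 2))"
  proof (rule sum_mono)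
    fix g assume g: "g \<in> ?P"
    have "(\<Prod>z\<leftarrow>tl g. hop_weight \<kappa> s u z) \<le> r ^ length (tl g)"
      using assms g by (intro prod_hop_weight_le_power) (force simp: return_sites_def)
    then show "(\<Prod>z\<leftarrow>tl g. hop_weight \<kappa> s u z) \<le> r ^ (2 * N + 2)"
      using path_tl(1)[OF g] by simp
  qed
  also have "\<dots> = real (card ?P) * r ^ (2 * N + 2)" by simp
  also have "\<dots> \<le> real (return_count TYPE('d) (Suc N)) * r ^ (2 * N + 2)"
    by (intro mult_right_mono zero_le_even_power) (auto simp: return_count_def intro!: sum_nonneg)
  finally show "return_sum \<kappa> (Suc N) s u - return_sum \<kappa> N s u
      \<le> real (return_count TYPE('d) (Suc N)) * r ^ (2 * N + 2)"
    using eq by simp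
qed

end

text \<open>The ratio of the weights of a path at \<open>s\<close> and \<open>s'\<close> is at most \<open>(1 + w)\<^bsup>2N\<^esup>\<close> with \<open>w = (s' - s) r / \<kappa>\<close>.
  With \<open>r\<close> of order \<open>1/s\<close> the right-hand side has the order \<open>s\<^bsup>-3\<^esup>\<close> that a derivative of a sum of order
  \<open>s\<^bsup>-2\<^esup>\<close> should have.\<close>

lemma return_sum_increment:
  fixes u :: "int ^ 'd \<Rightarrow> real"
  assumes \<kappa>: "\<kappa> > 0" and "s \<le> s'"
    and r: "\<And>z. z \<in> return_sites N \<Longrightarrow> hop_weight \<kappa> s u z \<le> r" "0 \<le> r" "r \<le> 1"
    and w: "(s' - s) * r / \<kappa> \<le> 1"
  shows "return_sum \<kappa> N s u - return_sum \<kappa> N s' u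
    \<le> 4 ^ N * real (return_count TYPE('d) N) / \<kappa> * r ^ 3 * (s' - s)"
proof -
  define w where "w = (s' - s) * r / \<kappa>"
  have w01: "0 \<le> w" "w \<le> 1" using assms by (auto simp: w_def)
  have "return_sum \<kappa> N s u \<le> return_sum \<kappa> N s' u * (1 + 4 ^ N * w)"
    unfolding return_sum_def sum_distrib_right
  proof (intro sum_mono)
    fix j and g :: "(int ^ 'd) list" assume j: "j \<in> {1..N}" and g: "g \<in> paths (2 * j + 1) 0 0"
    have "(\<Prod>z\<leftarrow>tl g. hop_weight \<kappa> s u z) \<le> (\<Prod>z\<leftarrow>tl g. hop_weight \<kappa> s' u z) * (1 + w) ^ length (tl g)"
      unfolding w_def using r j g
      by (intro prod_hop_weight_le_increment[OF \<kappa>] assms) (force simp: return_sites_def)+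
    also have "\<dots> \<le> (\<Prod>z\<leftarrow>tl g. hop_weight \<kappa> s' u z) * (1 + 4 ^ N * w)"
    proof (intro mult_left_mono prod_hop_weight_nonneg[OF \<kappa>])
      have "(1 + w) ^ length (tl g) \<le> (1 + w) ^ (2 * N)"
        using path_tl(1)[OF g] j w01 by (intro power_increasing) auto
      also have "\<dots> \<le> 1 + 2 ^ (2 * N) * w" by (rule one_plus_power_le[OF w01])
      finally show "(1 + w) ^ length (tl g) \<le> 1 + 4 ^ N * w" by (simp add: power_mult)
    qed
    finally show "(\<Prod>z\<leftarrow>tl g. hop_weight \<kappa> s u z) \<le> (\<Prod>z\<leftarrow>tl g. hop_weight \<kappa> s' u z) * (1 + 4 ^ N * w)" .
  qed
  then have "return_sum \<kappa> N s u - return_sum \<kappa> N s' u \<le> return_sum \<kappa> N s' u * (4 ^ N * w)"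
    by (simp add: algebra_simps)
  also have "\<dots> \<le> (real (return_count TYPE('d) N) * r\<^sup>2) * (4 ^ N * w)"
  proof (intro mult_right_mono return_sum_le_square[OF \<kappa>])
    fix z :: "int ^ 'd" assume "z \<in> return_sites N"
    then show "hop_weight \<kappa> s' u z \<le> r"
      using r(1) hop_weight_antimono[OF \<kappa> assms(2), of u z] order_trans by blast
  qed (use r w01 in auto)
  finally show ?thesis
    by (simp add: w_def power2_eq_square power3_eq_cube mult_ac)
qed

section \<open>Energy of a calm potential\<close>

definition energy :: "real \<Rightarrow> real \<Rightarrow> nat \<Rightarrow> real \<Rightarrow> (int ^ 'd \<Rightarrow> real) \<Rightarrow> real" where
  "energy \<kappa> \<rho> N s u = B_fun \<kappa> N s u powr \<rho> / \<rho>"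

text \<open>The factor \<open>1/4\<close> is chosen such that \<open>s \<ge> x/2\<close> leaves \<open>s - u\<^sub>0(z) \<ge> x/4\<close> at every site of \<open>Z\<close>.\<close>

definition calm :: "real \<Rightarrow> (int ^ 'd) set \<Rightarrow> (int ^ 'd \<Rightarrow> real) \<Rightarrow> bool" where
  "calm x Z u \<longleftrightarrow> (\<forall>z\<in>Z. zero_at_origin u z \<le> x / 4)"

lemma calm_hop_weight_le:
  fixes u :: "int ^ 'd \<Rightarrow> real"
  assumes "\<kappa> > 0" "x > 0" "x / 2 \<le> s" "calm x Z u" "z \<in> Z"
  shows "hop_weight \<kappa> s u z \<le> 4 * \<kappa> / x"
proof -
  have "x / 4 \<le> 2 * real CARD('d) * \<kappa> + max 0 (s - zero_at_origin u z)"
    using assms by (force simp: calm_def intro: add_increasing)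
  then have "hop_weight \<kappa> s u z \<le> \<kappa> / (x / 4)"
    unfolding hop_weight_def using assms by (intro divide_left_mono mult_pos_pos) auto
  then show ?thesis by (simp add: mult_ac)
qed

text \<open>The range \<open>s + D = x + O(1/x)\<close> contains all points that occur in the expansion; there \<open>s\<close> and \<open>x\<close> are
  comparable.\<close>

lemma near_bounds:
  fixes K D :: real
  assumes "D \<ge> 0"
  shows "\<forall>\<^sub>F x in at_top. \<forall>s. \<bar>s + D - x\<bar> \<le> K / x \<longrightarrow> x / 2 \<le> s \<and> s + D \<le> 2 * x"
  using eventually_ge_at_top[of 1] eventually_ge_at_top[of "4 * D"] eventually_ge_at_top[of "4 * \<bar>K\<bar>"]
proof eventually_elim
  case (elim x)
  have "K / x \<le> \<bar>K\<bar> / 1" using elim by (intro frac_le) auto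
  then show ?case using elim by auto
qed

lemma return_sites_mono: "return_sites N \<subseteq> return_sites (Suc N)"
  unfolding return_sites_def by (intro UN_mono) auto

text \<open>For calm potentials the sum over paths is \<open>O(x\<^bsup>-2\<^esup>)\<close>, so the denominator moves \<open>s + D\<close> by \<open>O(1/x)\<close> only.\<close>

lemma B_fun_near:
  fixes K \<kappa> :: real and N :: nat
  assumes \<kappa>: "\<kappa> > 0"
  shows "\<exists>K'. \<forall>\<^sub>F x in at_top. \<forall>s. \<forall>u :: int ^ 'd \<Rightarrow> real.
     \<bar>s + 2 * real CARD('d) * \<kappa> - x\<bar> \<le> K / x \<longrightarrow> calm x (return_sites N) u \<longrightarrow>
     \<bar>B_fun \<kappa> N s u - x\<bar> \<le> K' / x"
proof -
  define D where "D = 2 * real CARD('d) * \<kappa>"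
  define p where "p = real (return_count TYPE('d) N)"
  have D: "D \<ge> 0" using \<kappa> by (simp add: D_def)
  have "\<forall>\<^sub>F x in at_top. \<forall>s. \<forall>u :: int ^ 'd \<Rightarrow> real.
     \<bar>s + D - x\<bar> \<le> K / x \<longrightarrow> calm x (return_sites N) u \<longrightarrow>
     \<bar>B_fun \<kappa> N s u - x\<bar> \<le> (K + 32 * p * \<kappa>\<^sup>2) / x"
    using near_bounds[OF D, of K] eventually_ge_at_top[of 1] eventually_ge_at_top[of "4 * \<kappa>"]
  proof eventually_elim
    case (elim x)
    show ?case
    proof (intro allI impI)
      fix s and u :: "int ^ 'd \<Rightarrow> real"
      assume s: "\<bar>s + D - x\<bar> \<le> K / x" and u: "calm x (return_sites N) u"
      define S where "S = return_sum \<kappa> N s u"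
      have sx: "x / 2 \<le> s" "s + D \<le> 2 * x" using elim(1) s by auto
      have S0: "0 \<le> S" unfolding S_def by (rule return_sum_nonneg[OF \<kappa>])
      have S: "S \<le> p * (4 * \<kappa> / x)\<^sup>2"
        unfolding S_def p_def using elim \<kappa> sx u
        by (intro return_sum_le_square[OF \<kappa>] calm_hop_weight_le) auto
      have "(s + D) - B_fun \<kappa> N s u = (s + D) * (S / (1 + S))"
        using S0 by (simp add: B_fun_eq D_def S_def field_simps)
      moreover have "(s + D) * (S / (1 + S)) \<le> (2 * x) * S"
      proof (intro mult_mono)
        show "S / (1 + S) \<le> S" using S0 by (simp add: field_simps)
      qed (use sx S0 elim in auto)
      moreover have "(2 * x) * S \<le> (2 * x) * (p * (4 * \<kappa> / x)\<^sup>2)"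
        using S elim by (intro mult_left_mono) auto
      moreover have "(2 * x) * (p * (4 * \<kappa> / x)\<^sup>2) = 32 * p * \<kappa>\<^sup>2 / x"
        using elim by (simp add: power2_eq_square)
      moreover have "0 \<le> (s + D) * (S / (1 + S))"
        using sx elim D S0 by auto
      ultimately show "\<bar>B_fun \<kappa> N s u - x\<bar> \<le> (K + 32 * p * \<kappa>\<^sup>2) / x"
        using s unfolding add_divide_distrib by linarith
    qed
  qed
  then show ?thesis unfolding D_def by blast
qed

text \<open>With \<open>b\<close> and \<open>c\<close> the values of \<open>B\<^sub>N\<close> at \<open>s\<close> and \<open>s'\<close>, \<open>c - b = (s' - s)(1 + O(x\<^bsup>-2\<^esup>))\<close>, because the sum over
  paths is \<open>O(x\<^bsup>-2\<^esup>)\<close> and its increments are \<open>O((s' - s) x\<^bsup>-3\<^esup>)\<close>. The increment of the power is then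
  controlled near \<open>x\<close>.\<close>

lemma energy_increment:
  fixes K \<kappa> \<rho> :: real and N :: nat
  assumes \<kappa>: "\<kappa> > 0" and \<rho>: "\<rho> > 1"
  shows "\<exists>C\<ge>0. \<forall>\<^sub>F x in at_top. \<forall>s s'. \<forall>u :: int ^ 'd \<Rightarrow> real.
     \<bar>s + 2 * real CARD('d) * \<kappa> - x\<bar> \<le> K / x \<longrightarrow> \<bar>s' + 2 * real CARD('d) * \<kappa> - x\<bar> \<le> K / x \<longrightarrow>
     calm x (return_sites N) u \<longrightarrow>
     \<bar>energy \<kappa> \<rho> N s' u - energy \<kappa> \<rho> N s u - (s' - s) * x powr (\<rho> - 1)\<bar>
       \<le> C * \<bar>s' - s\<bar> * (x powr (\<rho> - 1) / x\<^sup>2)"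
proof -
  define D where "D = 2 * real CARD('d) * \<kappa>"
  have D: "D \<ge> 0" using \<kappa> by (simp add: D_def)
  define p where "p = real (return_count TYPE('d) N)"
  define C2 where "C2 = 2 * (4 ^ N * p / \<kappa>) * (4 * \<kappa>) ^ 3 + p * (4 * \<kappa>)\<^sup>2"
  have C2: "C2 \<ge> 0" using \<kappa> by (simp add: C2_def p_def)
  obtain K' where K': "\<forall>\<^sub>F x in at_top. \<forall>s. \<forall>u :: int ^ 'd \<Rightarrow> real.
     \<bar>s + D - x\<bar> \<le> K / x \<longrightarrow> calm x (return_sites N) u \<longrightarrow> \<bar>B_fun \<kappa> N s u - x\<bar> \<le> K' / x"
    using B_fun_near[OF \<kappa>, where K = K and N = N and 'd = 'd] unfolding D_def by blast
  obtain C1 where C1: "C1 \<ge> 0" "\<forall>\<^sub>F x in at_top. \<forall>b c. \<bar>b - x\<bar> \<le> K' / x \<longrightarrow> \<bar>c - x\<bar> \<le> K' / x \<longrightarrow>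
     \<bar>c powr \<rho> / \<rho> - b powr \<rho> / \<rho> - (c - b) * x powr (\<rho> - 1)\<bar>
       \<le> C1 * \<bar>c - b\<bar> * (x powr (\<rho> - 1) / x\<^sup>2)"
    using powr_increment_near[OF \<rho>, where K = K'] by blast
  define C where "C = C1 * (1 + C2) + C2"
  have "\<forall>\<^sub>F x in at_top. \<forall>s s'. \<forall>u :: int ^ 'd \<Rightarrow> real. s \<le> s' \<longrightarrow>
     \<bar>s + D - x\<bar> \<le> K / x \<longrightarrow> \<bar>s' + D - x\<bar> \<le> K / x \<longrightarrow> calm x (return_sites N) u \<longrightarrow>
     \<bar>energy \<kappa> \<rho> N s' u - energy \<kappa> \<rho> N s u - (s' - s) * x powr (\<rho> - 1)\<bar>
       \<le> C * (s' - s) * (x powr (\<rho> - 1) / x\<^sup>2)"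
    using near_bounds[OF D, of K] K' C1(2) eventually_ge_at_top[of 1]
      eventually_ge_at_top[of "4 * \<kappa>"] eventually_ge_at_top[of "8 * \<bar>K\<bar>"]
  proof eventually_elim
    case (elim x)
    show ?case
    proof (intro allI impI)
      fix s s' and u :: "int ^ 'd \<Rightarrow> real"
      assume le: "s \<le> s'" and s: "\<bar>s + D - x\<bar> \<le> K / x" and s': "\<bar>s' + D - x\<bar> \<le> K / x"
        and u: "calm x (return_sites N) u"
      define S S' where "S = return_sum \<kappa> N s u" and "S' = return_sum \<kappa> N s' u"
      define b c where "b = B_fun \<kappa> N s u" and "c = B_fun \<kappa> N s' u"
      define X where "X = x powr (\<rho> - 1) / x\<^sup>2"
      have sx: "x / 2 \<le> s" "s + D \<le> 2 * x" "x / 2 \<le> s'" using elim(1) s s' by auto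
      have hop: "hop_weight \<kappa> s u z \<le> 4 * \<kappa> / x" "hop_weight \<kappa> s' u z \<le> 4 * \<kappa> / x"
        if "z \<in> return_sites N" for z
        using elim \<kappa> sx u that by (auto intro!: calm_hop_weight_le)
      have S: "0 \<le> S'" "S' \<le> S"
        unfolding S_def S'_def by (intro return_sum_nonneg[OF \<kappa>] return_sum_antimono[OF \<kappa>] le)+
      have S'_le: "S' \<le> p * (4 * \<kappa> / x)\<^sup>2"
        unfolding S'_def p_def using elim \<kappa> hop by (intro return_sum_le_square[OF \<kappa>]) auto
      have diff: "S - S' \<le> 4 ^ N * p / \<kappa> * (4 * \<kappa> / x) ^ 3 * (s' - s)"
        unfolding S_def S'_def p_def
      proof (intro return_sum_increment[OF \<kappa> le] hop)
        have "K / x \<le> \<bar>K\<bar> / 1" using elim by (intro frac_le) auto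
        then have "8 * (K / x) \<le> 8 * \<bar>K\<bar>" by (intro mult_left_mono) auto
        also have "\<dots> \<le> x" by (rule elim)
        finally have "8 * (K / x) \<le> x" .
        moreover have "s' - s \<le> K / x + K / x" using s s' unfolding abs_le_iff by linarith
        ultimately have "4 * (s' - s) \<le> x" by argo
        moreover have "(s' - s) * (4 * \<kappa> / x) / \<kappa> = 4 * (s' - s) / x" using \<kappa> by simp
        ultimately show "(s' - s) * (4 * \<kappa> / x) / \<kappa> \<le> 1" using elim(4) by simp
      qed (use elim \<kappa> in auto)
      have triangle: "\<bar>e\<bar> \<le> U + V" if "e = P - Q" "P \<le> P'" "0 \<le> P" "P' \<le> U" "Q \<le> V" "0 \<le> Q" "0 \<le> V"
        for e P P' Q U V :: real
        using that by linarith
      have "c - b - (s' - s) = (s + D) * (S / (1 + S) - S' / (1 + S')) - (s' - s) * (S' / (1 + S'))"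
      proof -
        have "b = (s + D) - (s + D) * (S / (1 + S))" "c = (s' + D) - (s' + D) * (S' / (1 + S'))"
          using S by (simp_all add: b_def c_def B_fun_eq D_def S_def S'_def field_simps)
        moreover have "((s' + D) - (s' + D) * q') - ((s + D) - (s + D) * q) - (s' - s)
            = (s + D) * (q - q') - (s' - s) * q'" for q q' by (simp add: algebra_simps)
        ultimately show ?thesis by (simp only:)
      qed
      moreover have "(s + D) * (S / (1 + S) - S' / (1 + S')) \<le> (2 * x) * (S - S')"
      proof (intro mult_mono)
        have "S / (1 + S) - S' / (1 + S') = (S - S') / ((1 + S) * (1 + S'))"
          using S by (simp add: field_simps)
        also have "\<dots> \<le> (S - S') / 1"
          using S mult_mono[of 1 "1 + S" 1 "1 + S'"] by (intro divide_left_mono) auto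
        finally show "S / (1 + S) - S' / (1 + S') \<le> S - S'" by simp
        show "0 \<le> S / (1 + S) - S' / (1 + S')"
          using S by (simp add: field_simps)
      qed (use sx elim in auto)
      moreover have "0 \<le> (s + D) * (S / (1 + S) - S' / (1 + S'))"
        using sx S elim D by (intro mult_nonneg_nonneg) (simp_all add: field_simps)
      moreover have "(2 * x) * (S - S') \<le> (2 * x) * (4 ^ N * p / \<kappa> * (4 * \<kappa> / x) ^ 3 * (s' - s))"
        using diff elim by (intro mult_left_mono) auto
      moreover have "(s' - s) * (S' / (1 + S')) \<le> (s' - s) * (p * (4 * \<kappa> / x)\<^sup>2)"
      proof (intro mult_left_mono)
        have "S' / (1 + S') \<le> S'" using S by (simp add: field_simps)
        then show "S' / (1 + S') \<le> p * (4 * \<kappa> / x)\<^sup>2" using S'_le by simp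
      qed (use le in auto)
      moreover have "0 \<le> (s' - s) * (S' / (1 + S'))"
        using le S by (intro mult_nonneg_nonneg) auto
      moreover have "0 \<le> (s' - s) * (p * (4 * \<kappa> / x)\<^sup>2)"
        using le by (intro mult_nonneg_nonneg) (auto simp: p_def)
      ultimately have "\<bar>c - b - (s' - s)\<bar>
          \<le> (2 * x) * (4 ^ N * p / \<kappa> * (4 * \<kappa> / x) ^ 3 * (s' - s)) + (s' - s) * (p * (4 * \<kappa> / x)\<^sup>2)"
        by (rule triangle)
      also have "\<dots> = C2 * (s' - s) / x\<^sup>2"
        using elim by (simp add: C2_def field_simps power2_eq_square power3_eq_cube)
      finally have cb: "\<bar>c - b - (s' - s)\<bar> \<le> C2 * (s' - s) / x\<^sup>2" .
      have "C2 * (s' - s) / x\<^sup>2 \<le> C2 * (s' - s) / 1"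
        using elim le C2 by (intro divide_left_mono mult_nonneg_nonneg) auto
      then have cb': "\<bar>c - b\<bar> \<le> (1 + C2) * (s' - s)"
        using cb le by (simp add: algebra_simps)
      have "\<bar>b - x\<bar> \<le> K' / x" "\<bar>c - x\<bar> \<le> K' / x"
        using elim(2) s s' u by (auto simp: b_def c_def)
      then have "\<bar>c powr \<rho> / \<rho> - b powr \<rho> / \<rho> - (c - b) * x powr (\<rho> - 1)\<bar> \<le> C1 * \<bar>c - b\<bar> * X"
        using elim(3) by (simp add: X_def)
      also have "\<dots> \<le> C1 * ((1 + C2) * (s' - s)) * X"
        using cb' C1(1) by (intro mult_right_mono mult_left_mono) (auto simp: X_def)
      finally have 1: "\<bar>c powr \<rho> / \<rho> - b powr \<rho> / \<rho> - (c - b) * x powr (\<rho> - 1)\<bar>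
          \<le> C1 * ((1 + C2) * (s' - s)) * X" .
      have "\<bar>(c - b) * x powr (\<rho> - 1) - (s' - s) * x powr (\<rho> - 1)\<bar> = \<bar>c - b - (s' - s)\<bar> * x powr (\<rho> - 1)"
        by (simp add: abs_mult flip: left_diff_distrib)
      also have "\<dots> \<le> C2 * (s' - s) / x\<^sup>2 * x powr (\<rho> - 1)"
        using cb by (intro mult_right_mono) auto
      finally have 2: "\<bar>(c - b) * x powr (\<rho> - 1) - (s' - s) * x powr (\<rho> - 1)\<bar> \<le> C2 * (s' - s) * X"
        by (simp add: X_def)
      have "C * (s' - s) * X = C1 * ((1 + C2) * (s' - s)) * X + C2 * (s' - s) * X"
        by (simp add: C_def algebra_simps)
      then show "\<bar>energy \<kappa> \<rho> N s' u - energy \<kappa> \<rho> N s u - (s' - s) * x powr (\<rho> - 1)\<bar>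
       \<le> C * (s' - s) * (x powr (\<rho> - 1) / x\<^sup>2)"
        using 1 2 unfolding energy_def b_def[symmetric] c_def[symmetric] X_def[symmetric] by linarith
    qed
  qed
  then have "\<forall>\<^sub>F x in at_top. \<forall>s s'. \<forall>u :: int ^ 'd \<Rightarrow> real.
     \<bar>s + D - x\<bar> \<le> K / x \<longrightarrow> \<bar>s' + D - x\<bar> \<le> K / x \<longrightarrow> calm x (return_sites N) u \<longrightarrow>
     \<bar>energy \<kappa> \<rho> N s' u - energy \<kappa> \<rho> N s u - (s' - s) * x powr (\<rho> - 1)\<bar>
       \<le> C * \<bar>s' - s\<bar> * (x powr (\<rho> - 1) / x\<^sup>2)"
  proof eventually_elim
    case (elim x)
    show ?case
    proof (intro allI impI)
      fix s s' and u :: "int ^ 'd \<Rightarrow> real"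
      assume *: "\<bar>s + D - x\<bar> \<le> K / x" "\<bar>s' + D - x\<bar> \<le> K / x" "calm x (return_sites N) u"
      show "\<bar>energy \<kappa> \<rho> N s' u - energy \<kappa> \<rho> N s u - (s' - s) * x powr (\<rho> - 1)\<bar>
       \<le> C * \<bar>s' - s\<bar> * (x powr (\<rho> - 1) / x\<^sup>2)"
      proof (cases "s \<le> s'")
        case True
        then show ?thesis using elim * by simp
      next
        case False
        then have "\<bar>energy \<kappa> \<rho> N s u - energy \<kappa> \<rho> N s' u - (s - s') * x powr (\<rho> - 1)\<bar>
            \<le> C * (s - s') * (x powr (\<rho> - 1) / x\<^sup>2)"
          using elim * by simp
        moreover have "energy \<kappa> \<rho> N s u - energy \<kappa> \<rho> N s' u - (s - s') * x powr (\<rho> - 1)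
            = - (energy \<kappa> \<rho> N s' u - energy \<kappa> \<rho> N s u - (s' - s) * x powr (\<rho> - 1))"
          by (simp add: algebra_simps)
        ultimately show ?thesis using False by (simp only: abs_minus_cancel) simp
      qed
    qed
  qed
  moreover have "C \<ge> 0" using C1 C2 by (simp add: C_def)
  ultimately show ?thesis unfolding D_def by blast
qed

text \<open>The paths that \<open>B\<^bsub>N+1\<^esub>\<close> adds have \<open>2N + 2\<close> weights of order \<open>1/x\<close> each; multiplication by the numerator
  of order \<open>x\<close> gives a change of \<open>B\<close> of order \<open>x\<^bsup>-(2N+1)\<^esup>\<close>.\<close>

lemma energy_Suc_diff:
  fixes K \<kappa> \<rho> :: real and N :: nat
  assumes \<kappa>: "\<kappa> > 0" and \<rho>: "\<rho> > 1"
  shows "\<exists>C\<ge>0. \<forall>\<^sub>F x in at_top. \<forall>s. \<forall>u :: int ^ 'd \<Rightarrow> real.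
     \<bar>s + 2 * real CARD('d) * \<kappa> - x\<bar> \<le> K / x \<longrightarrow> calm x (return_sites (Suc N)) u \<longrightarrow>
     \<bar>energy \<kappa> \<rho> N s u - energy \<kappa> \<rho> (Suc N) s u\<bar> \<le> C * (x powr (\<rho> - 1) / x ^ (2 * N + 1))"
proof -
  define D where "D = 2 * real CARD('d) * \<kappa>"
  have D: "D \<ge> 0" using \<kappa> by (simp add: D_def)
  define p where "p = real (return_count TYPE('d) (Suc N))"
  define C2 where "C2 = 2 * p * (4 * \<kappa>) ^ (2 * N + 2)"
  have C2: "C2 \<ge> 0" using \<kappa> by (simp add: C2_def p_def)
  obtain K1 where K1: "\<forall>\<^sub>F x in at_top. \<forall>s. \<forall>u :: int ^ 'd \<Rightarrow> real.
     \<bar>s + D - x\<bar> \<le> K / x \<longrightarrow> calm x (return_sites N) u \<longrightarrow> \<bar>B_fun \<kappa> N s u - x\<bar> \<le> K1 / x"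
    using B_fun_near[OF \<kappa>, where K = K and N = N and 'd = 'd] unfolding D_def by blast
  obtain K2 where K2: "\<forall>\<^sub>F x in at_top. \<forall>s. \<forall>u :: int ^ 'd \<Rightarrow> real.
     \<bar>s + D - x\<bar> \<le> K / x \<longrightarrow> calm x (return_sites (Suc N)) u \<longrightarrow> \<bar>B_fun \<kappa> (Suc N) s u - x\<bar> \<le> K2 / x"
    using B_fun_near[OF \<kappa>, where K = K and N = "Suc N" and 'd = 'd] unfolding D_def by blast
  obtain C1 where C1: "C1 \<ge> 0" "\<forall>\<^sub>F x in at_top. \<forall>b c. \<bar>b - x\<bar> \<le> max K1 K2 / x \<longrightarrow> \<bar>c - x\<bar> \<le> max K1 K2 / x \<longrightarrow>
     \<bar>c powr \<rho> / \<rho> - b powr \<rho> / \<rho> - (c - b) * x powr (\<rho> - 1)\<bar>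
       \<le> C1 * \<bar>c - b\<bar> * (x powr (\<rho> - 1) / x\<^sup>2)"
    using powr_increment_near[OF \<rho>, where K = "max K1 K2"] by blast
  have "\<forall>\<^sub>F x in at_top. \<forall>s. \<forall>u :: int ^ 'd \<Rightarrow> real.
     \<bar>s + D - x\<bar> \<le> K / x \<longrightarrow> calm x (return_sites (Suc N)) u \<longrightarrow>
     \<bar>energy \<kappa> \<rho> N s u - energy \<kappa> \<rho> (Suc N) s u\<bar> \<le> (C1 + 1) * C2 * (x powr (\<rho> - 1) / x ^ (2 * N + 1))"
    using near_bounds[OF D, of K] K1 K2 C1(2) eventually_ge_at_top[of 1]
  proof eventually_elim
    case (elim x)
    show ?case
    proof (intro allI impI)
      fix s and u :: "int ^ 'd \<Rightarrow> real"
      assume s: "\<bar>s + D - x\<bar> \<le> K / x" and u: "calm x (return_sites (Suc N)) u"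
      define S S' where "S = return_sum \<kappa> N s u" and "S' = return_sum \<kappa> (Suc N) s u"
      define c b where "c = B_fun \<kappa> N s u" and "b = B_fun \<kappa> (Suc N) s u"
      have uN: "calm x (return_sites N) u" using u return_sites_mono by (auto simp: calm_def)
      have sx: "x / 2 \<le> s" "s + D \<le> 2 * x" using elim(1) s by auto
      have hop: "hop_weight \<kappa> s u z \<le> 4 * \<kappa> / x" if "z \<in> return_sites (Suc N)" for z
        using elim \<kappa> sx u that by (auto intro!: calm_hop_weight_le)
      have S: "0 \<le> S" "S \<le> S'" "S' - S \<le> p * (4 * \<kappa> / x) ^ (2 * N + 2)"
        unfolding S_def S'_def p_def
        using return_sum_nonneg[OF \<kappa>] return_sum_Suc_diff[OF \<kappa> hop] by auto
      have eq: "c - b = (s + D) * ((S' - S) / ((1 + S) * (1 + S')))"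
        using S by (simp add: b_def c_def B_fun_eq S_def S'_def D_def field_simps)
      have cb0: "0 \<le> c - b" unfolding eq using sx S D elim by (intro mult_nonneg_nonneg divide_nonneg_nonneg) auto
      have "c - b \<le> (2 * x) * (p * (4 * \<kappa> / x) ^ (2 * N + 2))"
        unfolding eq
      proof (intro mult_mono)
        have "(S' - S) / ((1 + S) * (1 + S')) \<le> (S' - S) / 1"
          using S mult_mono[of 1 "1 + S" 1 "1 + S'"] by (intro divide_left_mono) auto
        then show "(S' - S) / ((1 + S) * (1 + S')) \<le> p * (4 * \<kappa> / x) ^ (2 * N + 2)"
          using S by simp
      qed (use sx elim S in auto)
      also have "\<dots> = C2 / x ^ (2 * N + 1)"
        using elim by (simp add: C2_def field_simps)
      finally have cb: "c - b \<le> C2 / x ^ (2 * N + 1)" .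
      have "K1 / x \<le> max K1 K2 / x" "K2 / x \<le> max K1 K2 / x"
        using elim by (auto intro!: divide_right_mono)
      then have "\<bar>b - x\<bar> \<le> max K1 K2 / x" "\<bar>c - x\<bar> \<le> max K1 K2 / x"
        using elim(2,3) s u uN unfolding b_def c_def by (meson order_trans)+
      then have "\<bar>c powr \<rho> / \<rho> - b powr \<rho> / \<rho> - (c - b) * x powr (\<rho> - 1)\<bar>
          \<le> C1 * \<bar>c - b\<bar> * (x powr (\<rho> - 1) / x\<^sup>2)"
        using elim(4) by blast
      also have "\<dots> \<le> C1 * (c - b) * (x powr (\<rho> - 1) / 1)"
        using C1(1) cb0 elim by (intro mult_mono divide_left_mono) auto
      finally have "\<bar>c powr \<rho> / \<rho> - b powr \<rho> / \<rho>\<bar> \<le> C1 * (c - b) * x powr (\<rho> - 1) + \<bar>(c - b) * x powr (\<rho> - 1)\<bar>"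
        by simp
      also have "\<bar>(c - b) * x powr (\<rho> - 1)\<bar> = (c - b) * x powr (\<rho> - 1)"
        using cb0 by (intro abs_of_nonneg mult_nonneg_nonneg) auto
      also have "C1 * (c - b) * x powr (\<rho> - 1) + \<dots> = (C1 + 1) * (c - b) * x powr (\<rho> - 1)"
        by (simp add: algebra_simps)
      also have "\<dots> \<le> (C1 + 1) * (C2 / x ^ (2 * N + 1)) * x powr (\<rho> - 1)"
        using cb C1(1) by (intro mult_right_mono mult_left_mono) auto
      finally show "\<bar>energy \<kappa> \<rho> N s u - energy \<kappa> \<rho> (Suc N) s u\<bar> \<le> (C1 + 1) * C2 * (x powr (\<rho> - 1) / x ^ (2 * N + 1))"
        by (simp add: energy_def b_def c_def)
    qed
  qed
  then show ?thesis
    using C1(1) C2 unfolding D_def by (intro exI[of _ "(C1 + 1) * C2"]) auto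
qed

section \<open>Averages over the potential\<close>

text \<open>A field of random variables with the common tail \<open>exp(- y\<^sup>\<rho> / \<rho>)\<close>. The parameter \<open>D\<close> names
  the constant \<open>2d\<kappa>\<close>, in which the dimension is otherwise present only through the type of sites.\<close>

locale weibull_field = prob_space \<mu> for \<mu> :: "'w measure" +
  fixes v :: "int ^ 'd \<Rightarrow> 'w \<Rightarrow> real" and \<kappa> \<rho> D :: real
  assumes \<kappa>: "\<kappa> > 0" and \<rho>: "\<rho> > 1"
    and measurable_v [measurable]: "v z \<in> borel_measurable \<mu>"
    and tail: "y \<ge> 0 \<Longrightarrow> prob {w \<in> space \<mu>. v z w > y} = exp (- (y powr \<rho> / \<rho>))"
    and D_def: "D = 2 * real CARD('d) * \<kappa>"
begin

abbreviation field_at :: "'w \<Rightarrow> int ^ 'd \<Rightarrow> real" where "field_at w \<equiv> (\<lambda>z. v z w)"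

text \<open>The level equation is solved for \<open>- log \<zeta>\<close>, which behaves like \<open>(s + D)\<^sup>\<rho> / \<rho>\<close>.\<close>

definition free_energy :: "nat \<Rightarrow> real \<Rightarrow> real" where
  "free_energy N s = - ln (zeta \<mu> v \<kappa> \<rho> N s)"

definition calm_event :: "real \<Rightarrow> (int ^ 'd) set \<Rightarrow> 'w set" where
  "calm_event x Z = {w \<in> space \<mu>. calm x Z (field_at w)}"

lemma D_pos: "D > 0"
  using \<kappa> by (simp add: D_def)

lemma B_fun_alt: "B_fun \<kappa> N s u = (s + D) / (1 + return_sum \<kappa> N s u)" for u :: "int ^ 'd \<Rightarrow> real"
  by (simp add: B_fun_eq D_def)

lemma measurable_hop_weight [measurable]:
  "(\<lambda>w. hop_weight \<kappa> s (field_at w) z) \<in> borel_measurable \<mu>"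
  by (cases "z = 0") (simp_all add: hop_weight_def zero_at_origin_def)

lemma measurable_return_sum [measurable]:
  "(\<lambda>w. return_sum \<kappa> N s (field_at w)) \<in> borel_measurable \<mu>"
proof -
  have "(\<lambda>w. \<Prod>z\<leftarrow>g. hop_weight \<kappa> s (field_at w) z) \<in> borel_measurable \<mu>" for g
    by (induction g) simp_all
  then show ?thesis
    unfolding return_sum_def by measurable
qed

lemma measurable_energy [measurable]:
  "(\<lambda>w. energy \<kappa> \<rho> N s (field_at w)) \<in> borel_measurable \<mu>"
  unfolding energy_def B_fun_alt by measurable

lemma energy_nonneg: "energy \<kappa> \<rho> N s u \<ge> 0"
  using \<rho> by (simp add: energy_def)

lemma integrable_exp_energy: "integrable \<mu> (\<lambda>w. exp (- energy \<kappa> \<rho> N s (field_at w)))"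
  by (rule integrable_const_bound[of _ 1]) (auto intro!: energy_nonneg)

lemma integrable_indicator_mult:
  "A \<in> events \<Longrightarrow> integrable \<mu> f \<Longrightarrow> integrable \<mu> (\<lambda>w. indicator A w * f w)" for f :: "'w \<Rightarrow> real"
  using integrable_real_mult_indicator[of A \<mu> f] by (simp add: mult.commute)

lemma zeta_eq: "zeta \<mu> v \<kappa> \<rho> N s = expectation (\<lambda>w. exp (- energy \<kappa> \<rho> N s (field_at w)))"
  by (simp add: zeta_def energy_def)

lemma B_fun_pos: "s \<ge> 0 \<Longrightarrow> B_fun \<kappa> N s u > 0" for u :: "int ^ 'd \<Rightarrow> real"
  unfolding B_fun_alt using D_pos return_sum_nonneg[OF \<kappa>, of N s u]
  by (intro divide_pos_pos) auto

text \<open>Also for \<open>s < - D\<close>, where \<open>B\<^sub>N\<close> is negative: the real power extends evenly to negative bases. The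
  iterates may reach this range while \<open>x\<close> is small.\<close>

lemma energy_le: "energy \<kappa> \<rho> N s u \<le> \<bar>s + D\<bar> powr \<rho> / \<rho>" for u :: "int ^ 'd \<Rightarrow> real"
proof -
  have S: "return_sum \<kappa> N s u \<ge> 0" by (rule return_sum_nonneg[OF \<kappa>])
  have "\<bar>B_fun \<kappa> N s u\<bar> = \<bar>s + D\<bar> / (1 + return_sum \<kappa> N s u)"
    using S by (simp add: B_fun_alt)
  also have "\<dots> \<le> \<bar>s + D\<bar> / 1" using S by (intro divide_left_mono) auto
  finally have "\<bar>B_fun \<kappa> N s u\<bar> powr \<rho> \<le> \<bar>s + D\<bar> powr \<rho>"
    using \<rho> by (intro powr_mono2) auto
  moreover have "\<bar>B_fun \<kappa> N s u\<bar> powr \<rho> = B_fun \<kappa> N s u powr \<rho>"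
    by (simp add: abs_if powr_def ln_minus)
  ultimately show ?thesis using \<rho> by (simp add: energy_def divide_right_mono)
qed

lemma zeta_bounds:
  "exp (- (\<bar>s + D\<bar> powr \<rho> / \<rho>)) \<le> zeta \<mu> v \<kappa> \<rho> N s" "zeta \<mu> v \<kappa> \<rho> N s \<le> 1"
proof -
  have "expectation (\<lambda>w. exp (- (\<bar>s + D\<bar> powr \<rho> / \<rho>))) \<le> zeta \<mu> v \<kappa> \<rho> N s"
    unfolding zeta_eq by (intro integral_mono integrable_exp_energy) (auto intro: energy_le)
  then show "exp (- (\<bar>s + D\<bar> powr \<rho> / \<rho>)) \<le> zeta \<mu> v \<kappa> \<rho> N s"
    by (simp add: prob_space)
  have "zeta \<mu> v \<kappa> \<rho> N s \<le> expectation (\<lambda>w. 1)"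
    unfolding zeta_eq by (intro integral_mono integrable_exp_energy) (auto intro: energy_nonneg)
  then show "zeta \<mu> v \<kappa> \<rho> N s \<le> 1"
    by (simp add: prob_space)
qed

lemma zeta_pos: "zeta \<mu> v \<kappa> \<rho> N s > 0"
  using zeta_bounds(1) exp_gt_zero less_le_trans by blast

lemma exp_cost: "exp (- free_energy N s) = zeta \<mu> v \<kappa> \<rho> N s"
  using zeta_pos by (simp add: free_energy_def)

lemma free_energy_bounds: "0 \<le> free_energy N s" "free_energy N s \<le> \<bar>s + D\<bar> powr \<rho> / \<rho>"
proof -
  show "0 \<le> free_energy N s" using zeta_bounds(2) zeta_pos by (simp add: free_energy_def)
  have "exp (- (\<bar>s + D\<bar> powr \<rho> / \<rho>)) \<le> exp (- free_energy N s)" unfolding exp_cost by (rule zeta_bounds)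
  then show "free_energy N s \<le> \<bar>s + D\<bar> powr \<rho> / \<rho>" by simp
qed

lemma free_energy_0: "free_energy 0 s = (s + D) powr \<rho> / \<rho>"
proof -
  have "zeta \<mu> v \<kappa> \<rho> 0 s = exp (- ((s + D) powr \<rho> / \<rho>))"
    unfolding zeta_eq by (simp add: energy_def B_fun_alt return_sum_def prob_space)
  then show ?thesis by (simp add: free_energy_def)
qed

lemma calm_event_measurable [measurable]:
  assumes "finite Z"
  shows "calm_event x Z \<in> events"
proof -
  have "{w \<in> space \<mu>. zero_at_origin (field_at w) z \<le> x / 4} \<in> events" for z
    by (cases "z = 0") (simp_all add: zero_at_origin_def)
  then show ?thesis
    unfolding calm_event_def calm_def using assms by (intro sets.sets_Collect_finite_All) auto
qed

lemma prob_not_calm_le: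
  assumes "finite Z" "x \<ge> 0"
  shows "prob (space \<mu> - calm_event x Z) \<le> real (card Z) * exp (- ((x / 4) powr \<rho> / \<rho>))"
proof -
  have "prob (space \<mu> - calm_event x Z) \<le> prob (\<Union>z\<in>Z. {w \<in> space \<mu>. v z w > x / 4})"
    using assms by (intro finite_measure_mono) (auto simp: calm_event_def calm_def zero_at_origin_def split: if_splits)
  also have "\<dots> \<le> (\<Sum>z\<in>Z. prob {w \<in> space \<mu>. v z w > x / 4})"
    using assms by (intro finite_measure_subadditive_finite) auto
  also have "\<dots> = real (card Z) * exp (- ((x / 4) powr \<rho> / \<rho>))"
    using assms tail[of "x / 4"] by (simp del: less_divide_eq_numeral1 divide_less_eq_numeral1)
  finally show ?thesis .
qed

text \<open>Valid for every potential: the sum over paths is at most a constant over \<open>s + D\<close>, so it lowers \<open>B\<^sub>N\<close> by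
  at most a constant.\<close>

lemma energy_ge:
  fixes u :: "int ^ 'd \<Rightarrow> real"
  assumes "s \<ge> 0"
  shows "(s + D) powr \<rho> / \<rho> - real (return_count TYPE('d) N) * \<kappa> * (s + D) powr (\<rho> - 1)
    \<le> energy \<kappa> \<rho> N s u"
proof -
  define S where "S = return_sum \<kappa> N s u"
  have S: "0 \<le> S" "S \<le> real (return_count TYPE('d) N) * (\<kappa> / (s + D))"
    unfolding S_def using return_sum_nonneg[OF \<kappa>] return_sum_le_inverse[OF \<kappa> assms, of _ u, folded D_def] by auto
  have sD: "s + D > 0" using assms D_pos by simp
  have eq: "s + D - B_fun \<kappa> N s u = (s + D) * (S / (1 + S))"
    using S by (simp add: B_fun_alt S_def field_simps)
  have "(s + D) * (S / (1 + S)) \<le> (s + D) * (real (return_count TYPE('d) N) * (\<kappa> / (s + D)))"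
  proof (intro mult_left_mono)
    have "S / (1 + S) \<le> S" using S by (simp add: field_simps)
    then show "S / (1 + S) \<le> real (return_count TYPE('d) N) * (\<kappa> / (s + D))" using S by simp
  qed (use sD in auto)
  also have "\<dots> = real (return_count TYPE('d) N) * \<kappa>" using sD by simp
  finally have gap: "s + D - B_fun \<kappa> N s u \<le> real (return_count TYPE('d) N) * \<kappa>" unfolding eq .
  have "0 \<le> (s + D) * (S / (1 + S))" using sD S by (intro mult_nonneg_nonneg) auto
  then have "(s + D) powr \<rho> / \<rho> - energy \<kappa> \<rho> N s u \<le> (s + D - B_fun \<kappa> N s u) * (s + D) powr (\<rho> - 1)"
    unfolding energy_def using eq \<rho> by (intro powr_increment_le B_fun_pos assms) auto
  also have "\<dots> \<le> real (return_count TYPE('d) N) * \<kappa> * (s + D) powr (\<rho> - 1)"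
    using gap by (intro mult_right_mono) auto
  finally show ?thesis by simp
qed

text \<open>On the complement of the calm event the integrand exceeds \<open>exp(- (s + D)\<^sup>\<rho> / \<rho>)\<close> by a factor of at most
  \<open>exp(c (2x)\<^bsup>\<rho>-1\<^esup>)\<close>, and on the calm event it is never below this value. The probability
  of the complement, of order \<open>exp(- (x/4)\<^sup>\<rho> / \<rho>)\<close>, absorbs that factor and any power of \<open>x\<close>.\<close>

lemma not_calm_negligible:
  fixes K :: real and N m :: nat
  assumes Z: "finite Z"
  shows "\<forall>\<^sub>F x in at_top. \<forall>s. \<bar>s + D - x\<bar> \<le> K / x \<longrightarrow>
    expectation (\<lambda>w. indicator (space \<mu> - calm_event x Z) w * exp (- energy \<kappa> \<rho> N s (field_at w)))
    \<le> (1 / x ^ m) * expectation (\<lambda>w. indicator (calm_event x Z) w * exp (- energy \<kappa> \<rho> N s (field_at w)))"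
proof -
  define c where "c = real (return_count TYPE('d) N) * \<kappa>"
  have c: "c \<ge> 0" using \<kappa> by (simp add: c_def)
  have D0: "D \<ge> 0" using D_pos by simp
  show ?thesis
    using near_bounds[OF D0, of K] eventually_ge_at_top[of 1]
      atypical_weight_negligible[OF \<rho>, of "2 * real (card Z)" c 0]
      atypical_weight_negligible[OF \<rho>, of "2 * real (card Z)" c m]
  proof eventually_elim
    case (elim x)
    define q where "q = real (card Z) * exp (- ((x / 4) powr \<rho> / \<rho>))"
    define e where "e = exp (c * (2 * x) powr (\<rho> - 1))"
    have "1 \<le> e" using c by (simp add: e_def)
    have q: "0 \<le> q" by (simp add: q_def)
    have qe: "2 * (q * e) \<le> 1" "2 * (q * e) \<le> 1 / x ^ m"
      using elim(3,4) by (simp_all add: q_def e_def exp_diff exp_minus field_simps)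
    have "2 * (q * 1) \<le> 2 * (q * e)" using \<open>1 \<le> e\<close> q by (intro mult_left_mono) auto
    then have q_half: "q \<le> 1 / 2" using qe by simp
    have p_not: "prob (space \<mu> - calm_event x Z) \<le> q"
      unfolding q_def using elim Z by (intro prob_not_calm_le) auto
    then have p_calm: "1 / 2 \<le> prob (calm_event x Z)"
      using q_half prob_compl[OF calm_event_measurable[OF Z]] by simp
    show ?case
    proof (intro allI impI)
      fix s assume s: "\<bar>s + D - x\<bar> \<le> K / x"
      have sx: "0 \<le> s" "s + D \<le> 2 * x" using elim(1,2) s by force+
      define E where "E = exp (- ((s + D) powr \<rho> / \<rho>))"
      let ?f = "\<lambda>w. exp (- energy \<kappa> \<rho> N s (field_at w))"
      note [measurable] = calm_event_measurable[OF Z]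
      have up: "?f w \<le> E * e" for w
      proof -
        have "c * (s + D) powr (\<rho> - 1) \<le> c * (2 * x) powr (\<rho> - 1)"
          using c sx D_pos \<rho> by (intro mult_left_mono powr_mono2) auto
        then have "- energy \<kappa> \<rho> N s (field_at w) \<le> - ((s + D) powr \<rho> / \<rho>) + c * (2 * x) powr (\<rho> - 1)"
          using energy_ge[OF sx(1), of N "field_at w"] by (simp add: c_def)
        then show ?thesis by (simp add: E_def e_def flip: exp_add)
      qed
      have lo: "E \<le> ?f w" for w
        using energy_le[of N s "field_at w"] sx D_pos by (simp add: E_def)
      have "expectation (\<lambda>w. indicator (space \<mu> - calm_event x Z) w * ?f w)
          \<le> expectation (\<lambda>w. indicator (space \<mu> - calm_event x Z) w * (E * e))"
        using up by (intro integral_mono mult_left_mono integrable_indicator_mult integrable_exp_energy) auto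
      also have "\<dots> = prob (space \<mu> - calm_event x Z) * (E * e)"
        by simp
      also have "\<dots> \<le> q * (E * e)"
        using p_not by (intro mult_right_mono) (auto simp: E_def e_def)
      also have "\<dots> = (2 * (q * e)) * (1 / 2 * E)" by simp
      also have "\<dots> \<le> (1 / x ^ m) * (prob (calm_event x Z) * E)"
        using qe p_calm elim by (intro mult_mono) (auto simp: E_def)
      also have "prob (calm_event x Z) * E = expectation (\<lambda>w. indicator (calm_event x Z) w * E)"
        by simp
      also have "(1 / x ^ m) * \<dots> \<le> (1 / x ^ m) * expectation (\<lambda>w. indicator (calm_event x Z) w * ?f w)"
        using lo elim by (intro mult_left_mono integral_mono integrable_indicator_mult integrable_exp_energy) auto
      finally show "expectation (\<lambda>w. indicator (space \<mu> - calm_event x Z) w * ?f w)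
         \<le> (1 / x ^ m) * expectation (\<lambda>w. indicator (calm_event x Z) w * ?f w)" .
    qed
  qed
qed

text \<open>Transfers a pointwise one-sided bound on an event to the logarithm of the expectations, when the
  complement contributes little to one of the two. Exchanging the roles gives the other side.\<close>

lemma free_energy_comparison:
  assumes T: "T \<in> events" and \<epsilon>: "\<epsilon> \<ge> 0"
    and le: "\<And>w. w \<in> T \<Longrightarrow> energy \<kappa> \<rho> N' s' (field_at w) - energy \<kappa> \<rho> N s (field_at w) \<le> b"
    and small: "expectation (\<lambda>w. indicator (space \<mu> - T) w * exp (- energy \<kappa> \<rho> N s (field_at w)))
       \<le> \<epsilon> * expectation (\<lambda>w. indicator T w * exp (- energy \<kappa> \<rho> N s (field_at w)))"
  shows "free_energy N' s' - free_energy N s \<le> b + \<epsilon>"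
proof -
  let ?f = "\<lambda>w. exp (- energy \<kappa> \<rho> N s (field_at w))"
  let ?g = "\<lambda>w. exp (- energy \<kappa> \<rho> N' s' (field_at w))"
  note int = integrable_indicator_mult[OF _ integrable_exp_energy]
  have "zeta \<mu> v \<kappa> \<rho> N s = expectation (\<lambda>w. indicator T w * ?f w + indicator (space \<mu> - T) w * ?f w)"
    unfolding zeta_eq by (intro Bochner_Integration.integral_cong) (auto simp: indicator_def)
  also have "\<dots> = expectation (\<lambda>w. indicator T w * ?f w) + expectation (\<lambda>w. indicator (space \<mu> - T) w * ?f w)"
    using T by (intro Bochner_Integration.integral_add int) auto
  also have "\<dots> \<le> (1 + \<epsilon>) * expectation (\<lambda>w. indicator T w * ?f w)"
    using small by (simp add: algebra_simps)
  also have "\<dots> \<le> (1 + \<epsilon>) * expectation (\<lambda>w. exp b * ?g w)"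
  proof (intro mult_left_mono integral_mono int)
    fix w assume "w \<in> space \<mu>"
    show "indicator T w * ?f w \<le> exp b * ?g w"
      using le[of w] by (auto simp: indicator_def simp flip: exp_add)
  qed (use T \<epsilon> integrable_exp_energy in auto)
  also have "\<dots> = (1 + \<epsilon>) * (exp b * zeta \<mu> v \<kappa> \<rho> N' s')"
    by (simp add: zeta_eq)
  also have "\<dots> \<le> exp \<epsilon> * (exp b * zeta \<mu> v \<kappa> \<rho> N' s')"
    using zeta_pos exp_ge_add_one_self[of \<epsilon>] by (intro mult_right_mono) (auto intro: less_imp_le)
  finally have "exp (- free_energy N s) \<le> exp (\<epsilon> + (b - free_energy N' s'))"
    by (simp add: exp_cost[symmetric] flip: exp_add)
  then show ?thesis by simp
qed

text \<open>On the complement of the calm event only the size of the contribution is controlled, not its change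
  with \<open>s\<close>; hence an additive error that does not shrink with \<open>s' - s\<close>. It is below every power of \<open>1/x\<close>, and
  so below the precision to which the steps of the scheme are known.\<close>

lemma free_energy_increment:
  fixes K :: real and N m :: nat
  shows "\<exists>C\<ge>0. \<forall>\<^sub>F x in at_top. \<forall>s s'. \<bar>s + D - x\<bar> \<le> K / x \<longrightarrow> \<bar>s' + D - x\<bar> \<le> K / x \<longrightarrow>
    \<bar>free_energy N s' - free_energy N s - (s' - s) * x powr (\<rho> - 1)\<bar>
      \<le> C * \<bar>s' - s\<bar> * (x powr (\<rho> - 1) / x\<^sup>2) + 1 / x ^ m"
proof -
  let ?Z = "return_sites N :: (int ^ 'd) set"
  obtain C where C: "C \<ge> 0" "\<forall>\<^sub>F x in at_top. \<forall>s s'. \<forall>u :: int ^ 'd \<Rightarrow> real.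
     \<bar>s + D - x\<bar> \<le> K / x \<longrightarrow> \<bar>s' + D - x\<bar> \<le> K / x \<longrightarrow> calm x ?Z u \<longrightarrow>
     \<bar>energy \<kappa> \<rho> N s' u - energy \<kappa> \<rho> N s u - (s' - s) * x powr (\<rho> - 1)\<bar>
       \<le> C * \<bar>s' - s\<bar> * (x powr (\<rho> - 1) / x\<^sup>2)"
    using energy_increment[OF \<kappa> \<rho>, where K = K and N = N and 'd = 'd, folded D_def] by blast
  have "\<forall>\<^sub>F x in at_top. \<forall>s s'. \<bar>s + D - x\<bar> \<le> K / x \<longrightarrow> \<bar>s' + D - x\<bar> \<le> K / x \<longrightarrow>
    \<bar>free_energy N s' - free_energy N s - (s' - s) * x powr (\<rho> - 1)\<bar>
      \<le> C * \<bar>s' - s\<bar> * (x powr (\<rho> - 1) / x\<^sup>2) + 1 / x ^ m"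
    using C(2) not_calm_negligible[OF finite_return_sites, of K N N m] eventually_ge_at_top[of 1]
  proof eventually_elim
    case (elim x)
    have half: "free_energy N s' - free_energy N s - (s' - s) * x powr (\<rho> - 1)
        \<le> C * \<bar>s' - s\<bar> * (x powr (\<rho> - 1) / x\<^sup>2) + 1 / x ^ m"
      if s: "\<bar>s + D - x\<bar> \<le> K / x" and s': "\<bar>s' + D - x\<bar> \<le> K / x" for s s'
    proof -
      have "free_energy N s' - free_energy N s
        \<le> ((s' - s) * x powr (\<rho> - 1) + C * \<bar>s' - s\<bar> * (x powr (\<rho> - 1) / x\<^sup>2)) + 1 / x ^ m"
      proof (rule free_energy_comparison[OF calm_event_measurable[OF finite_return_sites]])
        fix w assume "w \<in> calm_event x ?Z"
        then have "calm x ?Z (field_at w)" by (simp add: calm_event_def)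
        then have "\<bar>energy \<kappa> \<rho> N s' (field_at w) - energy \<kappa> \<rho> N s (field_at w) - (s' - s) * x powr (\<rho> - 1)\<bar>
          \<le> C * \<bar>s' - s\<bar> * (x powr (\<rho> - 1) / x\<^sup>2)" using elim(1) s s' by blast
        then show "energy \<kappa> \<rho> N s' (field_at w) - energy \<kappa> \<rho> N s (field_at w)
          \<le> (s' - s) * x powr (\<rho> - 1) + C * \<bar>s' - s\<bar> * (x powr (\<rho> - 1) / x\<^sup>2)"
          by linarith
      next
        show "expectation (\<lambda>w. indicator (space \<mu> - calm_event x ?Z) w * exp (- energy \<kappa> \<rho> N s (field_at w)))
          \<le> (1 / x ^ m) * expectation (\<lambda>w. indicator (calm_event x ?Z) w * exp (- energy \<kappa> \<rho> N s (field_at w)))"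
          using elim(2) s by blast
      qed (use elim in auto)
      then show ?thesis by linarith
    qed
    show ?case
    proof (intro allI impI)
      fix s s' assume s: "\<bar>s + D - x\<bar> \<le> K / x" and s': "\<bar>s' + D - x\<bar> \<le> K / x"
      have "(s - s') * x powr (\<rho> - 1) = - ((s' - s) * x powr (\<rho> - 1))"
        by (simp add: algebra_simps)
      then show "\<bar>free_energy N s' - free_energy N s - (s' - s) * x powr (\<rho> - 1)\<bar>
        \<le> C * \<bar>s' - s\<bar> * (x powr (\<rho> - 1) / x\<^sup>2) + 1 / x ^ m"
        using half[OF s s'] half[OF s' s] unfolding abs_le_iff abs_minus_commute[of s s'] by linarith
    qed
  qed
  then show ?thesis using C(1) by blast
qed

text \<open>The additive error of the comparison is taken to be \<open>x\<^bsup>-(2N+1)\<^esup>\<close>, which the main term absorbs as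
  \<open>x\<^bsup>\<rho>-1\<^esup> \<ge> 1\<close>.\<close>

lemma free_energy_Suc_diff:
  fixes K :: real and N :: nat
  shows "\<exists>C\<ge>0. \<forall>\<^sub>F x in at_top. \<forall>s. \<bar>s + D - x\<bar> \<le> K / x \<longrightarrow>
    \<bar>free_energy N s - free_energy (Suc N) s\<bar> \<le> C * (x powr (\<rho> - 1) / x ^ (2 * N + 1))"
proof -
  let ?Z = "return_sites (Suc N) :: (int ^ 'd) set"
  obtain C where C: "C \<ge> 0" "\<forall>\<^sub>F x in at_top. \<forall>s. \<forall>u :: int ^ 'd \<Rightarrow> real.
     \<bar>s + D - x\<bar> \<le> K / x \<longrightarrow> calm x ?Z u \<longrightarrow>
     \<bar>energy \<kappa> \<rho> N s u - energy \<kappa> \<rho> (Suc N) s u\<bar> \<le> C * (x powr (\<rho> - 1) / x ^ (2 * N + 1))"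
    using energy_Suc_diff[OF \<kappa> \<rho>, where K = K and N = N and 'd = 'd, folded D_def] by blast
  have "\<forall>\<^sub>F x in at_top. \<forall>s. \<bar>s + D - x\<bar> \<le> K / x \<longrightarrow>
    \<bar>free_energy N s - free_energy (Suc N) s\<bar> \<le> (C + 1) * (x powr (\<rho> - 1) / x ^ (2 * N + 1))"
    using C(2) not_calm_negligible[OF finite_return_sites, of K "Suc N" N "2 * N + 1"]
      not_calm_negligible[OF finite_return_sites, of K "Suc N" "Suc N" "2 * N + 1"] eventually_ge_at_top[of 1]
  proof eventually_elim
    case (elim x)
    show ?case
    proof (intro allI impI)
      fix s assume s: "\<bar>s + D - x\<bar> \<le> K / x"
      have e: "\<bar>energy \<kappa> \<rho> N s (field_at w) - energy \<kappa> \<rho> (Suc N) s (field_at w)\<bar>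
          \<le> C * (x powr (\<rho> - 1) / x ^ (2 * N + 1))" if "w \<in> calm_event x ?Z" for w
        using elim(1) s that by (auto simp: calm_event_def)
      have "free_energy N s - free_energy (Suc N) s \<le> C * (x powr (\<rho> - 1) / x ^ (2 * N + 1)) + 1 / x ^ (2 * N + 1)"
      proof (rule free_energy_comparison[OF calm_event_measurable[OF finite_return_sites]])
        show "expectation (\<lambda>w. indicator (space \<mu> - calm_event x ?Z) w * exp (- energy \<kappa> \<rho> (Suc N) s (field_at w)))
          \<le> (1 / x ^ (2 * N + 1)) * expectation (\<lambda>w. indicator (calm_event x ?Z) w * exp (- energy \<kappa> \<rho> (Suc N) s (field_at w)))"
          using elim(3) s by blast
        show "0 \<le> 1 / x ^ (2 * N + 1)" using elim by simp
      qed (use e in force)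
      moreover have "free_energy (Suc N) s - free_energy N s \<le> C * (x powr (\<rho> - 1) / x ^ (2 * N + 1)) + 1 / x ^ (2 * N + 1)"
      proof (rule free_energy_comparison[OF calm_event_measurable[OF finite_return_sites]])
        show "expectation (\<lambda>w. indicator (space \<mu> - calm_event x ?Z) w * exp (- energy \<kappa> \<rho> N s (field_at w)))
          \<le> (1 / x ^ (2 * N + 1)) * expectation (\<lambda>w. indicator (calm_event x ?Z) w * exp (- energy \<kappa> \<rho> N s (field_at w)))"
          using elim(2) s by blast
        show "0 \<le> 1 / x ^ (2 * N + 1)" using elim by simp
      qed (use e in force)
      moreover have "1 / x ^ (2 * N + 1) \<le> x powr (\<rho> - 1) / x ^ (2 * N + 1)"
        using elim \<rho> by (intro divide_right_mono ge_one_powr_ge_zero) auto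
      moreover have "(C + 1) * (x powr (\<rho> - 1) / x ^ (2 * N + 1))
          = C * (x powr (\<rho> - 1) / x ^ (2 * N + 1)) + x powr (\<rho> - 1) / x ^ (2 * N + 1)"
        by (simp only: distrib_right mult_1)
      ultimately show "\<bar>free_energy N s - free_energy (Suc N) s\<bar> \<le> (C + 1) * (x powr (\<rho> - 1) / x ^ (2 * N + 1))"
        unfolding abs_le_iff by linarith
    qed
  qed
  then show ?thesis using C(1) by (intro exI[of _ "C + 1"]) auto
qed

section \<open>The level equation\<close>

lemma B_fun_strict_mono:
  fixes u :: "int ^ 'd \<Rightarrow> real"
  assumes "0 \<le> s" "s < s'"
  shows "B_fun \<kappa> N s u < B_fun \<kappa> N s' u"
  unfolding B_fun_alt using assms D_pos return_sum_nonneg[OF \<kappa>, of N s' u]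
    return_sum_antimono[OF \<kappa>, of s s' N u]
  by (intro frac_less) auto

lemma zeta_strict_antimono:
  assumes "0 \<le> s" "s < s'"
  shows "zeta \<mu> v \<kappa> \<rho> N s' < zeta \<mu> v \<kappa> \<rho> N s"
  unfolding zeta_eq
proof (rule integral_less_AE_space)
  have "energy \<kappa> \<rho> N s u < energy \<kappa> \<rho> N s' u" for u :: "int ^ 'd \<Rightarrow> real"
    unfolding energy_def using B_fun_strict_mono[OF assms] B_fun_pos[OF assms(1), of N u] \<rho>
    by (intro divide_strict_right_mono powr_less_mono2) (auto intro: less_imp_le)
  then show "AE w in \<mu>. exp (- energy \<kappa> \<rho> N s' (field_at w)) < exp (- energy \<kappa> \<rho> N s (field_at w))"
    by simp
qed (simp_all add: integrable_exp_energy emeasure_space_1)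

lemma zeta_less_iff:
  assumes "0 \<le> s" "0 \<le> s'"
  shows "zeta \<mu> v \<kappa> \<rho> N s' < zeta \<mu> v \<kappa> \<rho> N s \<longleftrightarrow> s < s'"
  using zeta_strict_antimono[of s s' N] zeta_strict_antimono[of s' s N] assms
  by (cases s s' rule: linorder_cases) auto

lemma continuous_on_energy: "continuous_on {0..} (\<lambda>s. energy \<kappa> \<rho> N s u)"
  for u :: "int ^ 'd \<Rightarrow> real"
proof -
  have "continuous_on {0..} (\<lambda>s. hop_weight \<kappa> s u z)" for z
    unfolding hop_weight_def using D_pos
    by (intro continuous_intros) (auto simp: D_def add_pos_nonneg intro!: less_imp_neq[symmetric])
  then have "continuous_on {0..} (\<lambda>s. \<Prod>z\<leftarrow>g. hop_weight \<kappa> s u z)" for g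
    by (induction g) (auto intro: continuous_intros)
  then have "continuous_on {0..} (\<lambda>s. return_sum \<kappa> N s u)"
    unfolding return_sum_def by (intro continuous_intros)
  moreover have "1 + return_sum \<kappa> N s u \<noteq> 0" for s
    using return_sum_nonneg[OF \<kappa>, of N s u] by simp
  ultimately have B: "continuous_on {0..} (\<lambda>s. B_fun \<kappa> N s u)"
    unfolding B_fun_alt by (intro continuous_intros) auto
  have "B_fun \<kappa> N s u \<noteq> 0" if "s \<ge> 0" for s
    using B_fun_pos[OF that, of N u] by simp
  then show ?thesis
    unfolding energy_def using \<rho> by (intro continuous_intros B) auto
qed

lemma continuous_on_zeta: "continuous_on {0..} (zeta \<mu> v \<kappa> \<rho> N)"
  unfolding continuous_on_sequentially
proof (intro allI ballI impI)
  fix S :: "nat \<Rightarrow> real" and s assume *: "s \<in> {0..}" "(\<forall>n. S n \<in> {0..}) \<and> S \<longlonglongrightarrow> s"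
  show "(zeta \<mu> v \<kappa> \<rho> N \<circ> S) \<longlonglongrightarrow> zeta \<mu> v \<kappa> \<rho> N s"
    unfolding o_def zeta_eq
  proof (rule integral_dominated_convergence[where w = "\<lambda>_. 1"])
    show "AE w in \<mu>. (\<lambda>n. exp (- energy \<kappa> \<rho> N (S n) (field_at w))) \<longlonglongrightarrow> exp (- energy \<kappa> \<rho> N s (field_at w))"
    proof (intro AE_I2 tendsto_intros)
      fix w
      show "(\<lambda>n. energy \<kappa> \<rho> N (S n) (field_at w)) \<longlonglongrightarrow> energy \<kappa> \<rho> N s (field_at w)"
        using continuous_on_energy[of N "field_at w"] * unfolding continuous_on_sequentially o_def by blast
    qed
  qed (auto simp: energy_nonneg)
qed

text \<open>Bounding all weights by \<open>1\<close> is enough to see that \<open>\<zeta>\<^sub>N\<close> tends to \<open>0\<close>.\<close>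

lemma zeta_le:
  assumes "s \<ge> 0"
  shows "zeta \<mu> v \<kappa> \<rho> N s \<le> exp (- ((s / (1 + real (return_count TYPE('d) N))) powr \<rho> / \<rho>))"
proof -
  let ?c = "real (return_count TYPE('d) N)"
  have "(s / (1 + ?c)) powr \<rho> / \<rho> \<le> energy \<kappa> \<rho> N s u" for u :: "int ^ 'd \<Rightarrow> real"
    unfolding energy_def
  proof (intro divide_right_mono powr_mono2)
    show "s / (1 + ?c) \<le> B_fun \<kappa> N s u"
      unfolding B_fun_alt using assms D_pos return_sum_nonneg[OF \<kappa>, of N s u]
        return_sum_le_count[OF \<kappa>, of N s u] by (intro frac_le) auto
  qed (use assms \<rho> in auto)
  then have "zeta \<mu> v \<kappa> \<rho> N s \<le> expectation (\<lambda>w. exp (- ((s / (1 + ?c)) powr \<rho> / \<rho>)))"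
    unfolding zeta_eq by (intro integral_mono integrable_exp_energy) auto
  then show ?thesis by (simp add: prob_space)
qed

lemma level_le:
  assumes "s \<ge> 0" "x \<ge> 0" "zeta \<mu> v \<kappa> \<rho> N s = exp (- (x powr \<rho> / \<rho>))"
  shows "s \<le> (1 + real (return_count TYPE('d) N)) * x"
proof (rule ccontr)
  let ?c = "1 + real (return_count TYPE('d) N)"
  assume "\<not> s \<le> ?c * x"
  then have "x < s / ?c" by (simp add: field_simps)
  then have "x powr \<rho> / \<rho> < (s / ?c) powr \<rho> / \<rho>"
    using assms \<rho> by (intro divide_strict_right_mono powr_less_mono2) auto
  then show False using zeta_le[OF assms(1), of N] assms(3) by simp
qed

text \<open>Almost surely the potential is positive at the finitely many sites visited, so at \<open>s = 0\<close> all positive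
  parts vanish.\<close>

lemma zeta_0: "zeta \<mu> v \<kappa> \<rho> N 0 = exp (- (1 / \<rho>) * B_const TYPE('d) \<kappa> N powr \<rho>)"
proof -
  have pos: "AE w in \<mu>. v z w > 0" for z
  proof -
    have "prob {w \<in> space \<mu>. v z w > 0} = 1" using tail[of 0 z] \<rho> by simp
    then show ?thesis by (subst (asm) prob_Collect_eq_1) auto
  qed
  have all_pos: "AE w in \<mu>. \<forall>z\<in>return_sites N. v z w > 0"
    using pos by (intro AE_finite_allI finite_return_sites)
  have B: "B_fun \<kappa> N 0 u = B_const TYPE('d) \<kappa> N" if "\<forall>z\<in>return_sites N. u z > 0" for u :: "int ^ 'd \<Rightarrow> real"
  proof -
    have "(\<Prod>z\<leftarrow>tl g. hop_weight \<kappa> 0 u z) = (1 / (2 * real CARD('d))) ^ (2 * j)"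
      if j: "j \<in> {1..N}" and g: "g \<in> paths (2 * j + 1) 0 0" for j g
    proof -
      have "hop_weight \<kappa> 0 u z = 1 / (2 * real CARD('d))" if "z \<in> set (tl g)" for z
      proof -
        have "z \<in> return_sites N" using that j g by (auto simp: return_sites_def)
        then have "0 < u z" using \<open>\<forall>z\<in>return_sites N. u z > 0\<close> by blast
        then show ?thesis using \<kappa> by (simp add: hop_weight_def zero_at_origin_def)
      qed
      then show ?thesis using path_tl(1)[OF g] j by (simp add: prod_list_const)
    qed
    then show ?thesis by (simp add: B_fun_eq return_sum_def B_const_def)
  qed
  have "zeta \<mu> v \<kappa> \<rho> N 0 = expectation (\<lambda>w. exp (- (B_const TYPE('d) \<kappa> N powr \<rho> / \<rho>)))"
    unfolding zeta_eq
  proof (rule integral_cong_AE)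
    show "AE w in \<mu>. exp (- energy \<kappa> \<rho> N 0 (field_at w)) = exp (- (B_const TYPE('d) \<kappa> N powr \<rho> / \<rho>))"
      using all_pos by eventually_elim (simp add: energy_def B)
  qed auto
  then show ?thesis by (simp add: prob_space)
qed

lemma ex1_level:
  assumes y: "0 < y" "y \<le> zeta \<mu> v \<kappa> \<rho> N 0"
  shows "\<exists>!s. s \<ge> 0 \<and> zeta \<mu> v \<kappa> \<rho> N s = y"
proof (rule ex_ex1I)
  have "y \<le> 1" using y zeta_bounds(2)[of N 0] by simp
  define x where "x = (- (\<rho> * ln y)) powr (1 / \<rho>)"
  have "x powr \<rho> = - (\<rho> * ln y)"
    using y \<open>y \<le> 1\<close> \<rho> by (simp add: x_def powr_powr mult_nonneg_nonpos)
  then have x: "exp (- (x powr \<rho> / \<rho>)) = y" using y \<rho> by simp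
  define b where "b = (1 + real (return_count TYPE('d) N)) * x"
  have b0: "b \<ge> 0" by (simp add: b_def x_def)
  have "zeta \<mu> v \<kappa> \<rho> N b \<le> y"
    using zeta_le[OF b0, of N] x by (simp add: b_def add_nonneg_eq_0_iff)
  then have "\<exists>s\<ge>0. s \<le> b \<and> zeta \<mu> v \<kappa> \<rho> N s = y"
    using y b0 by (intro IVT2' continuous_on_subset[OF continuous_on_zeta]) auto
  then show "\<exists>s. s \<ge> 0 \<and> zeta \<mu> v \<kappa> \<rho> N s = y" by blast
next
  fix s s' assume "s \<ge> 0 \<and> zeta \<mu> v \<kappa> \<rho> N s = y" "s' \<ge> 0 \<and> zeta \<mu> v \<kappa> \<rho> N s' = y"
  then have "\<not> s < s'" "\<not> s' < s"
    using zeta_strict_antimono[of s s' N] zeta_strict_antimono[of s' s N] by auto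
  then show "s = s'" by simp
qed

section \<open>Chord iterates\<close>

text \<open>Newton's scheme for \<open>F(s) = x\<^sup>\<rho> / \<rho>\<close> with the slope frozen at \<open>x\<^bsup>\<rho>-1\<^esup>\<close>; the \<open>j\<close>-th step uses the free
  energy of order \<open>j\<close>.\<close>

primrec chord_iterate :: "nat \<Rightarrow> real \<Rightarrow> real" where
  "chord_iterate 0 x = x - D"
| "chord_iterate (Suc j) x = chord_iterate j x + (x powr \<rho> / \<rho> - free_energy (Suc j) (chord_iterate j x)) / x powr (\<rho> - 1)"

text \<open>Passing to longer paths costs as much as the residual that is already there.\<close>

lemma chord_iterate_step_eventually:
  assumes near: "\<forall>\<^sub>F x in at_top. \<bar>chord_iterate j x + D - x\<bar> \<le> K / x"
    and residual: "\<forall>\<^sub>F x in at_top. \<bar>x powr \<rho> / \<rho> - free_energy j (chord_iterate j x)\<bar> \<le> R * (x powr (\<rho> - 1) / x ^ (2 * j + 1))"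
  shows "\<exists>C\<ge>0. \<forall>\<^sub>F x in at_top. \<bar>chord_iterate (Suc j) x - chord_iterate j x\<bar> \<le> C / x ^ (2 * j + 1)"
proof -
  obtain C where C: "C \<ge> 0" "\<forall>\<^sub>F x in at_top. \<forall>s. \<bar>s + D - x\<bar> \<le> K / x \<longrightarrow>
    \<bar>free_energy j s - free_energy (Suc j) s\<bar> \<le> C * (x powr (\<rho> - 1) / x ^ (2 * j + 1))"
    using free_energy_Suc_diff by blast
  have "\<forall>\<^sub>F x in at_top. \<bar>chord_iterate (Suc j) x - chord_iterate j x\<bar> \<le> (\<bar>R\<bar> + C) / x ^ (2 * j + 1)"
    using near residual C(2) eventually_gt_at_top[of 0]
  proof eventually_elim
    case (elim x)
    let ?X = "x powr (\<rho> - 1)"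
    have X: "?X > 0" using elim by simp
    have pos: "?X / x ^ (2 * j + 1) > 0" using elim by simp
    have "\<bar>free_energy j (chord_iterate j x) - free_energy (Suc j) (chord_iterate j x)\<bar> \<le> C * (?X / x ^ (2 * j + 1))"
      using elim(1,3) by blast
    moreover have "R * (?X / x ^ (2 * j + 1)) \<le> \<bar>R\<bar> * (?X / x ^ (2 * j + 1))"
      using pos by (intro mult_right_mono) auto
    ultimately have "\<bar>x powr \<rho> / \<rho> - free_energy (Suc j) (chord_iterate j x)\<bar> \<le> (\<bar>R\<bar> + C) * (?X / x ^ (2 * j + 1))"
      using elim(2) unfolding distrib_right by linarith
    then have "\<bar>x powr \<rho> / \<rho> - free_energy (Suc j) (chord_iterate j x)\<bar> / ?X \<le> (\<bar>R\<bar> + C) * (?X / x ^ (2 * j + 1)) / ?X"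
      using X by (intro divide_right_mono) auto
    then show ?case using X by simp
  qed
  then show ?thesis using C(1) by (intro exI[of _ "\<bar>R\<bar> + C"]) auto
qed

text \<open>The induction behind the expansion. The step is chosen to cancel the residual to first order, so the
  new residual is the error of the frozen slope, which gains the factor \<open>x\<^bsup>-2\<^esup>\<close>. At order \<open>0\<close> there are no
  paths and the residual vanishes.\<close>

lemma chord_iterate_residual:
  "\<exists>K R. (\<forall>\<^sub>F x in at_top. \<bar>chord_iterate j x + D - x\<bar> \<le> K / x) \<and>
    (\<forall>\<^sub>F x in at_top. \<bar>x powr \<rho> / \<rho> - free_energy j (chord_iterate j x)\<bar> \<le> R * (x powr (\<rho> - 1) / x ^ (2 * j + 1)))"
proof (induction j)
  case 0
  show ?case by (intro exI[of _ 0]) (auto simp: free_energy_0)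
next
  case (Suc j)
  then obtain K R where near: "\<forall>\<^sub>F x in at_top. \<bar>chord_iterate j x + D - x\<bar> \<le> K / x"
    and residual: "\<forall>\<^sub>F x in at_top. \<bar>x powr \<rho> / \<rho> - free_energy j (chord_iterate j x)\<bar> \<le> R * (x powr (\<rho> - 1) / x ^ (2 * j + 1))"
    by blast
  obtain C where C: "C \<ge> 0" "\<forall>\<^sub>F x in at_top. \<bar>chord_iterate (Suc j) x - chord_iterate j x\<bar> \<le> C / x ^ (2 * j + 1)"
    using chord_iterate_step_eventually[OF near residual] by blast
  have near': "\<forall>\<^sub>F x in at_top. \<bar>chord_iterate j x + D - x\<bar> \<le> (K + C) / x \<and> \<bar>chord_iterate (Suc j) x + D - x\<bar> \<le> (K + C) / x"
    using near C(2) eventually_ge_at_top[of 1]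
  proof eventually_elim
    case (elim x)
    have "C / x ^ (2 * j + 1) \<le> C / x ^ 1"
      using elim C(1) by (intro divide_left_mono power_increasing) auto
    moreover have "0 \<le> C / x" using elim C(1) by simp
    ultimately show ?case
      using elim(1,2) unfolding add_divide_distrib power_one_right by linarith
  qed
  obtain C' where C': "C' \<ge> 0" "\<forall>\<^sub>F x in at_top. \<forall>s s'. \<bar>s + D - x\<bar> \<le> (K + C) / x \<longrightarrow> \<bar>s' + D - x\<bar> \<le> (K + C) / x \<longrightarrow>
    \<bar>free_energy (Suc j) s' - free_energy (Suc j) s - (s' - s) * x powr (\<rho> - 1)\<bar>
      \<le> C' * \<bar>s' - s\<bar> * (x powr (\<rho> - 1) / x\<^sup>2) + 1 / x ^ (2 * Suc j + 1)"
    using free_energy_increment by blast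
  have "\<forall>\<^sub>F x in at_top. \<bar>x powr \<rho> / \<rho> - free_energy (Suc j) (chord_iterate (Suc j) x)\<bar>
      \<le> (C' * C + 1) * (x powr (\<rho> - 1) / x ^ (2 * Suc j + 1))"
    using near' C(2) C'(2) eventually_ge_at_top[of 1]
  proof eventually_elim
    case (elim x)
    let ?X = "x powr (\<rho> - 1)"
    have X: "?X \<ge> 1" using elim \<rho> by (intro ge_one_powr_ge_zero) auto
    define a b where "a = chord_iterate j x" and "b = chord_iterate (Suc j) x"
    have "(b - a) * ?X = x powr \<rho> / \<rho> - free_energy (Suc j) a"
      using elim(4) by (simp add: a_def b_def)
    then have "\<bar>x powr \<rho> / \<rho> - free_energy (Suc j) b\<bar> = \<bar>free_energy (Suc j) b - free_energy (Suc j) a - (b - a) * ?X\<bar>"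
      by (simp add: abs_minus_commute)
    also have "\<dots> \<le> C' * \<bar>b - a\<bar> * (?X / x\<^sup>2) + 1 / x ^ (2 * Suc j + 1)"
      using elim(1,3) unfolding a_def b_def by blast
    also have "\<dots> \<le> C' * (C / x ^ (2 * j + 1)) * (?X / x\<^sup>2) + ?X / x ^ (2 * Suc j + 1)"
      using elim(2,4) C'(1) X unfolding a_def b_def
      by (intro add_mono mult_right_mono mult_left_mono divide_right_mono) auto
    also have "C' * (C / x ^ (2 * j + 1)) * (?X / x\<^sup>2) = C' * C * (?X / x ^ (2 * Suc j + 1))"
      using elim by (simp add: power2_eq_square)
    finally show ?case by (simp only: b_def distrib_right mult_1)
  qed
  moreover have "\<forall>\<^sub>F x in at_top. \<bar>chord_iterate (Suc j) x + D - x\<bar> \<le> (K + C) / x"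
    using near' by (rule eventually_mono) simp
  ultimately show ?case by (intro exI conjI)
qed

text \<open>The values of \<open>F\<^sub>N\<close> at distance \<open>C x\<^bsup>-(2N+1)\<^esup>\<close> on both sides of the iterate bracket the level, and
  monotonicity then locates the root.\<close>

lemma level_near_iterate_eventually:
  "\<exists>C. \<forall>\<^sub>F x in at_top. \<forall>s\<ge>0. zeta \<mu> v \<kappa> \<rho> N s = exp (- (x powr \<rho> / \<rho>)) \<longrightarrow>
     \<bar>s - chord_iterate N x\<bar> \<le> C / x ^ (2 * N + 1)"
proof -
  obtain K R where near: "\<forall>\<^sub>F x in at_top. \<bar>chord_iterate N x + D - x\<bar> \<le> K / x"
    and residual: "\<forall>\<^sub>F x in at_top. \<bar>x powr \<rho> / \<rho> - free_energy N (chord_iterate N x)\<bar> \<le> R * (x powr (\<rho> - 1) / x ^ (2 * N + 1))"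
    using chord_iterate_residual[of N] by (elim exE conjE)
  \<comment> \<open>Over a distance \<open>C\<epsilon>\<close> the slope is at least half the frozen one, up to an error \<open>\<epsilon>\<close>: the gain \<open>C\<epsilon>/2 - \<epsilon>\<close>
    must exceed the residual \<open>\<bar>R\<bar>\<epsilon>\<close> (all in units of the frozen slope).\<close>
  define C where "C = 2 * \<bar>R\<bar> + 4"
  obtain C' where C': "C' \<ge> 0" "\<forall>\<^sub>F x in at_top. \<forall>s s'. \<bar>s + D - x\<bar> \<le> (K + C) / x \<longrightarrow> \<bar>s' + D - x\<bar> \<le> (K + C) / x \<longrightarrow>
    \<bar>free_energy N s' - free_energy N s - (s' - s) * x powr (\<rho> - 1)\<bar>
      \<le> C' * \<bar>s' - s\<bar> * (x powr (\<rho> - 1) / x\<^sup>2) + 1 / x ^ (2 * N + 1)"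
    using free_energy_increment by blast
  have D0: "D \<ge> 0" using D_pos by simp
  have "\<forall>\<^sub>F x in at_top. \<forall>s\<ge>0. zeta \<mu> v \<kappa> \<rho> N s = exp (- (x powr \<rho> / \<rho>)) \<longrightarrow>
     \<bar>s - chord_iterate N x\<bar> \<le> C / x ^ (2 * N + 1)"
    using near residual C'(2) near_bounds[OF D0, of "K + C"] eventually_ge_at_top[of 1] eventually_ge_at_top[of "2 * C'"]
  proof eventually_elim
    case (elim x)
    let ?X = "x powr (\<rho> - 1)"
    define a where "a = chord_iterate N x"
    define \<epsilon> where "\<epsilon> = 1 / x ^ (2 * N + 1)"
    have X: "?X \<ge> 1" using elim \<rho> by (intro ge_one_powr_ge_zero) auto
    have \<epsilon>: "0 < \<epsilon>" "C / x ^ (2 * N + 1) = C * \<epsilon>" using elim by (simp_all add: \<epsilon>_def)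
    have \<epsilon>x: "\<epsilon> \<le> 1 / x"
      unfolding \<epsilon>_def using elim power_increasing[of 1 "2 * N + 1" x] by (intro divide_left_mono) auto
    have C0: "C > 0" by (simp add: C_def)
    have "C * \<epsilon> \<le> C / x" using \<epsilon>x C0 mult_left_mono[OF \<epsilon>x, of C] by simp
    moreover have C\<epsilon>0: "0 \<le> C * \<epsilon>" using C0 \<epsilon> by simp
    ultimately have near_shift: "\<bar>(a + \<delta>) + D - x\<bar> \<le> (K + C) / x" if "\<bar>\<delta>\<bar> \<le> C * \<epsilon>" for \<delta>
      using elim(1) that unfolding a_def add_divide_distrib by linarith
    have shift_nonneg: "a + \<delta> \<ge> 0" if "\<bar>\<delta>\<bar> \<le> C * \<epsilon>" for \<delta>
      using near_shift[OF that] elim(4,5) by force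
    have x2: "C' / x\<^sup>2 \<le> 1 / 2"
    proof -
      have "2 * C' \<le> x * x" using elim(5,6) mult_left_mono[of 1 x x] by linarith
      then show ?thesis using elim by (simp add: field_simps power2_eq_square)
    qed
    have incr: "\<bar>free_energy N (a + \<delta>) - free_energy N a - \<delta> * ?X\<bar> \<le> (C * \<epsilon>) * ?X / 2 + \<epsilon> * ?X" if "\<bar>\<delta>\<bar> = C * \<epsilon>" for \<delta>
    proof -
      have "\<bar>free_energy N (a + \<delta>) - free_energy N a - ((a + \<delta>) - a) * ?X\<bar> \<le> C' * \<bar>(a + \<delta>) - a\<bar> * (?X / x\<^sup>2) + 1 / x ^ (2 * N + 1)"
      proof -
        have "\<bar>a + D - x\<bar> \<le> (K + C) / x" "\<bar>(a + \<delta>) + D - x\<bar> \<le> (K + C) / x"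
          using near_shift[of 0] near_shift[of \<delta>] that C\<epsilon>0 by simp_all
        then show ?thesis using elim(3) by blast
      qed
      also have "\<dots> = (C' / x\<^sup>2) * ((C * \<epsilon>) * ?X) + \<epsilon> * 1"
        using that by (simp add: \<epsilon>_def mult_ac)
      also have "\<dots> \<le> (1 / 2) * ((C * \<epsilon>) * ?X) + \<epsilon> * ?X"
        using x2 C0 \<epsilon> X by (intro add_mono mult_right_mono mult_left_mono) auto
      finally show ?thesis by simp
    qed
    have "R * (?X / x ^ (2 * N + 1)) \<le> \<bar>R\<bar> * (?X / x ^ (2 * N + 1))"
      using elim by (intro mult_right_mono) auto
    then have res: "\<bar>x powr \<rho> / \<rho> - free_energy N a\<bar> \<le> \<bar>R\<bar> * (\<epsilon> * ?X)"
      using elim(2) by (simp add: a_def \<epsilon>_def)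
    have half: "(C * \<epsilon>) * ?X / 2 = \<bar>R\<bar> * (\<epsilon> * ?X) + 2 * (\<epsilon> * ?X)" "(C * \<epsilon>) * ?X = 2 * (\<bar>R\<bar> * (\<epsilon> * ?X)) + 4 * (\<epsilon> * ?X)"
      by (simp_all add: C_def algebra_simps)
    have \<epsilon>X: "\<epsilon> * ?X > 0" using \<epsilon>(1) X by (intro mult_pos_pos) auto
    have C\<epsilon>: "\<bar>C * \<epsilon>\<bar> = C * \<epsilon>" "\<bar>- (C * \<epsilon>)\<bar> = C * \<epsilon>" using C0 \<epsilon> by simp_all
    have above: "x powr \<rho> / \<rho> < free_energy N (a + C * \<epsilon>)"
      using incr[OF C\<epsilon>(1)] res half \<epsilon>X unfolding abs_le_iff by linarith
    have below: "free_energy N (a + - (C * \<epsilon>)) < x powr \<rho> / \<rho>"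
      using incr[OF C\<epsilon>(2)] res half \<epsilon>X unfolding abs_le_iff mult_minus_left by linarith
    show ?case
    proof (intro allI impI)
      fix s assume s: "0 \<le> s" "zeta \<mu> v \<kappa> \<rho> N s = exp (- (x powr \<rho> / \<rho>))"
      have "zeta \<mu> v \<kappa> \<rho> N (a + C * \<epsilon>) < zeta \<mu> v \<kappa> \<rho> N s"
        using above s by (simp flip: exp_cost)
      then have "s < a + C * \<epsilon>"
        using zeta_less_iff[OF s(1) shift_nonneg[of "C * \<epsilon>"]] C\<epsilon> by simp
      moreover have "zeta \<mu> v \<kappa> \<rho> N s < zeta \<mu> v \<kappa> \<rho> N (a + - (C * \<epsilon>))"
        using below s by (simp flip: exp_cost)
      then have "a + - (C * \<epsilon>) < s"
        using zeta_less_iff[OF shift_nonneg[of "- (C * \<epsilon>)"] s(1)] C\<epsilon> by simp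
      ultimately show "\<bar>s - chord_iterate N x\<bar> \<le> C / x ^ (2 * N + 1)"
        unfolding \<epsilon>(2) a_def by linarith
    qed
  qed
  then show ?thesis by blast
qed

text \<open>The free energy is locally bounded, even where the iterates are negative.\<close>

lemma chord_iterate_bounded:
  assumes x0: "x0 > 0"
  shows "\<exists>K\<ge>0. \<forall>x\<in>{x0..X}. \<bar>chord_iterate j x\<bar> \<le> K"
proof (induction j)
  case 0
  show ?case using x0 D_pos by (intro exI[of _ "\<bar>X\<bar> + D"]) auto
next
  case (Suc j)
  then obtain K where K: "K \<ge> 0" "\<And>x. x \<in> {x0..X} \<Longrightarrow> \<bar>chord_iterate j x\<bar> \<le> K" by blast
  define E where "E = X powr \<rho> / \<rho> + (K + D) powr \<rho> / \<rho>"
  have E0: "E \<ge> 0" using \<rho> by (simp add: E_def)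
  have "\<bar>chord_iterate (Suc j) x\<bar> \<le> K + E / x0 powr (\<rho> - 1)" if x: "x \<in> {x0..X}" for x
  proof -
    have "free_energy (Suc j) (chord_iterate j x) \<le> (K + D) powr \<rho> / \<rho>"
    proof (rule order_trans[OF free_energy_bounds(2)])
      show "\<bar>chord_iterate j x + D\<bar> powr \<rho> / \<rho> \<le> (K + D) powr \<rho> / \<rho>"
        using K(2)[OF x] D_pos \<rho> by (intro divide_right_mono powr_mono2) auto
    qed
    moreover have "x powr \<rho> / \<rho> \<le> X powr \<rho> / \<rho>"
      using x x0 \<rho> by (intro divide_right_mono powr_mono2) auto
    moreover have "0 \<le> x powr \<rho> / \<rho>" using \<rho> by simp
    moreover have "0 \<le> free_energy (Suc j) (chord_iterate j x)" by (rule free_energy_bounds)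
    moreover have "0 \<le> X powr \<rho> / \<rho>" "0 \<le> (K + D) powr \<rho> / \<rho>" using \<rho> by simp_all
    ultimately have "\<bar>x powr \<rho> / \<rho> - free_energy (Suc j) (chord_iterate j x)\<bar> \<le> E"
      unfolding E_def abs_le_iff by linarith
    then have "\<bar>x powr \<rho> / \<rho> - free_energy (Suc j) (chord_iterate j x)\<bar> / x powr (\<rho> - 1) \<le> E / x0 powr (\<rho> - 1)"
      using x x0 \<rho> E0 by (intro frac_le powr_mono2) auto
    then have "\<bar>(x powr \<rho> / \<rho> - free_energy (Suc j) (chord_iterate j x)) / x powr (\<rho> - 1)\<bar> \<le> E / x0 powr (\<rho> - 1)"
      by (simp add: abs_divide)
    then show ?thesis using K(2)[OF x] unfolding chord_iterate.simps by linarith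
  qed
  moreover have "0 \<le> K + E / x0 powr (\<rho> - 1)" using K(1) E0 by simp
  ultimately show ?case by blast
qed

lemma chord_iterate_step_bound:
  assumes x0: "x0 > 0"
  shows "\<exists>C. \<forall>x\<ge>x0. \<bar>chord_iterate (Suc j) x - chord_iterate j x\<bar> \<le> C / x ^ (2 * j + 1)"
proof -
  obtain K R where near: "\<forall>\<^sub>F x in at_top. \<bar>chord_iterate j x + D - x\<bar> \<le> K / x"
    and residual: "\<forall>\<^sub>F x in at_top. \<bar>x powr \<rho> / \<rho> - free_energy j (chord_iterate j x)\<bar> \<le> R * (x powr (\<rho> - 1) / x ^ (2 * j + 1))"
    using chord_iterate_residual[of j] by (elim exE conjE)
  obtain C where C: "\<forall>\<^sub>F x in at_top. \<bar>chord_iterate (Suc j) x - chord_iterate j x\<bar> \<le> C / x ^ (2 * j + 1)"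
    using chord_iterate_step_eventually[OF near residual] by blast
  have "\<exists>C. \<forall>x\<ge>x0. \<forall>y. y = chord_iterate (Suc j) x - chord_iterate j x \<longrightarrow> \<bar>y\<bar> \<le> C / x ^ (2 * j + 1)"
  proof (rule bound_from_eventually[OF x0])
    show "\<forall>\<^sub>F x in at_top. \<forall>y. y = chord_iterate (Suc j) x - chord_iterate j x \<longrightarrow> \<bar>y\<bar> \<le> C / x ^ (2 * j + 1)"
      using C by simp
    fix X
    obtain K where K: "\<And>x. x \<in> {x0..X} \<Longrightarrow> \<bar>chord_iterate j x\<bar> \<le> K" using chord_iterate_bounded[OF x0] by blast
    obtain K' where K': "\<And>x. x \<in> {x0..X} \<Longrightarrow> \<bar>chord_iterate (Suc j) x\<bar> \<le> K'" using chord_iterate_bounded[OF x0] by blast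
    have "\<bar>chord_iterate (Suc j) x - chord_iterate j x\<bar> \<le> K + K'" if "x \<in> {x0..X}" for x
      using K[OF that] K'[OF that] by linarith
    then show "\<exists>K. \<forall>x\<in>{x0..X}. \<forall>y. y = chord_iterate (Suc j) x - chord_iterate j x \<longrightarrow> \<bar>y\<bar> \<le> K" by blast
  qed
  then show ?thesis by blast
qed

lemma level_near_iterate:
  assumes x0: "x0 > 0"
  shows "\<exists>C. \<forall>x\<ge>x0. \<forall>s\<ge>0. zeta \<mu> v \<kappa> \<rho> N s = exp (- (x powr \<rho> / \<rho>)) \<longrightarrow>
     \<bar>s - chord_iterate N x\<bar> \<le> C / x ^ (2 * N + 1)"
proof -
  obtain C where C: "\<forall>\<^sub>F x in at_top. \<forall>s\<ge>0. zeta \<mu> v \<kappa> \<rho> N s = exp (- (x powr \<rho> / \<rho>)) \<longrightarrow>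
     \<bar>s - chord_iterate N x\<bar> \<le> C / x ^ (2 * N + 1)"
    using level_near_iterate_eventually by blast
  let ?P = "\<lambda>x y. \<exists>s\<ge>0. zeta \<mu> v \<kappa> \<rho> N s = exp (- (x powr \<rho> / \<rho>)) \<and> y = s - chord_iterate N x"
  have "\<exists>C. \<forall>x\<ge>x0. \<forall>y. ?P x y \<longrightarrow> \<bar>y\<bar> \<le> C / x ^ (2 * N + 1)"
  proof (rule bound_from_eventually[OF x0])
    show "\<forall>\<^sub>F x in at_top. \<forall>y. ?P x y \<longrightarrow> \<bar>y\<bar> \<le> C / x ^ (2 * N + 1)"
      using C by eventually_elim blast
    fix X
    let ?c = "1 + real (return_count TYPE('d) N)"
    obtain K where K: "\<And>x. x \<in> {x0..X} \<Longrightarrow> \<bar>chord_iterate N x\<bar> \<le> K" using chord_iterate_bounded[OF x0] by blast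
    have "\<bar>s - chord_iterate N x\<bar> \<le> ?c * X + K"
      if x: "x \<in> {x0..X}" and s: "s \<ge> 0" "zeta \<mu> v \<kappa> \<rho> N s = exp (- (x powr \<rho> / \<rho>))" for x s
    proof -
      have "s \<le> ?c * x" using x x0 by (intro level_le s) auto
      also have "\<dots> \<le> ?c * X" using x by (intro mult_left_mono) auto
      finally show ?thesis using K[OF x] s(1) by linarith
    qed
    then show "\<exists>K. \<forall>x\<in>{x0..X}. \<forall>y. ?P x y \<longrightarrow> \<bar>y\<bar> \<le> K" by blast
  qed
  then show ?thesis by blast
qed

end

section \<open>The expansion of the solution\<close>

theorem theorem2:
  fixes \<mu> :: "'w measure"
    and v :: "int ^ 'd \<Rightarrow> 'w \<Rightarrow> real"
    and L :: "real \<Rightarrow> real"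
    and \<kappa> \<rho> \<rho>' \<gamma> t0 :: real
    and M :: nat
  assumes "\<kappa> > 0" and "\<rho> > 1" and "1 / \<rho> + 1 / \<rho>' = 1"
    and "0 < \<gamma>" and "\<gamma> < \<rho>' / \<rho> * 2 powr (1 / \<rho>')"
    and "prob_space \<mu>"
    and "prob_space.indep_vars \<mu> (\<lambda>_. borel) v UNIV"
    and "\<And>x. distr \<mu> borel (v x) = distr \<mu> borel (v 0)"
    and "\<And>y. y \<ge> 0 \<Longrightarrow> measure \<mu> {w \<in> space \<mu>. v 0 w > y} = exp (- (y powr \<rho> / \<rho>))"
    and "mono_on {0..} L" and "\<And>t. t \<ge> 0 \<Longrightarrow> L t \<ge> 1"
    and "M = M_index \<rho>'"
    and "t0 \<ge> 0"
    and "1 / L t0 ^ CARD('d) = exp (- (1 / \<rho>) * B_const TYPE('d) \<kappa> M powr \<rho>)"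
  shows "(\<exists>!h. level_solution \<mu> v \<kappa> \<rho> \<rho>' L t0 h)
    \<and> (\<forall>h. level_solution \<mu> v \<kappa> \<rho> \<rho>' L t0 h \<longrightarrow>
         O_on {t0..}
           (\<lambda>t. h t - (A_zero \<rho> \<rho>' \<gamma> * tau CARD('d) \<rho>' \<gamma> L t powr (\<rho>' - 1)
                       - 2 * real CARD('d) * \<kappa>
                       + (\<Sum>j=1..M. h_term \<mu> v \<kappa> \<rho> \<rho>' \<gamma> L j t)))
           (\<lambda>t. 1 / tau CARD('d) \<rho>' \<gamma> L t powr ((2 * real M + 1) * (\<rho>' / \<rho>))))
    \<and> (\<forall>j\<in>{1..M}.
         O_on {t0..} (h_term \<mu> v \<kappa> \<rho> \<rho>' \<gamma> L j)
           (\<lambda>t. 1 / tau CARD('d) \<rho>' \<gamma> L t powr ((2 * real j - 1) * (\<rho>' / \<rho>))))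
    \<and> (O_on {t0..} (\<lambda>t. t) (tau CARD('d) \<rho>' \<gamma> L) \<longrightarrow>
         (\<forall>h. level_solution \<mu> v \<kappa> \<rho> \<rho>' L t0 h \<longrightarrow>
            O_on ({t0..} \<inter> {0<..})
              (\<lambda>t. h t - (A_zero \<rho> \<rho>' \<gamma> * tau CARD('d) \<rho>' \<gamma> L t powr (\<rho>' - 1)
                          - 2 * real CARD('d) * \<kappa>
                          + (\<Sum>j=1..M. h_term \<mu> v \<kappa> \<rho> \<rho>' \<gamma> L j t)))
              (\<lambda>t. 1 / t powr ((2 * real M + 1) * (\<rho>' / \<rho>))))
       \<and> (\<forall>j\<in>{1..M}.
            O_on ({t0..} \<inter> {0<..}) (h_term \<mu> v \<kappa> \<rho> \<rho>' \<gamma> L j)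
              (\<lambda>t. 1 / t powr ((2 * real j - 1) * (\<rho>' / \<rho>)))))"
proof -
  define D where "D = 2 * real CARD('d) * \<kappa>"
  interpret prob_space \<mu> by fact
  have meas: "v z \<in> borel_measurable \<mu>" for z
    using assms(7) by (auto simp: indep_vars_def)
  have tail: "prob {w \<in> space \<mu>. v z w > y} = exp (- (y powr \<rho> / \<rho>))" if "y \<ge> 0" for z y
  proof -
    have "prob {w \<in> space \<mu>. v z w > y} = measure (distr \<mu> borel (v z)) {y<..}" for z
      using meas by (subst measure_distr) (auto simp: vimage_def Int_def conj_commute intro!: arg_cong[where f = prob])
    then show ?thesis using assms(8)[of z] assms(9)[OF that] by metis
  qed
  interpret F: weibull_field \<mu> v \<kappa> \<rho> D
    by unfold_locales (use assms(1,2) meas tail in \<open>auto simp: D_def\<close>)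
  define q where "q = \<rho>' - 1"
  define A where "A = A_zero \<rho> \<rho>' \<gamma>"
  let ?d = "CARD('d)"
  define \<tau> where "\<tau> = tau ?d \<rho>' \<gamma> L"
  \<comment> \<open>From here on \<open>t\<close> enters through \<open>x t\<close> only, and \<open>x\<close> stays above \<open>x t0 > 0\<close>.\<close>
  define x where "x t = A * \<tau> t powr q" for t
  have \<rho>'0: "\<rho>' \<noteq> 0" and \<rho>'1: "\<rho>' > 1"
  proof -
    have inv: "1 / \<rho>' = 1 - 1 / \<rho>" "0 < 1 - 1 / \<rho>" "1 - 1 / \<rho> < 1"
      using assms(2,3) by (auto simp: field_simps)
    then have "0 < 1 / \<rho>'" "1 / \<rho>' < 1" by simp_all
    then show "\<rho>' > 1" by (simp add: field_simps zero_less_divide_iff split: if_splits)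
    then show "\<rho>' \<noteq> 0" by simp
  qed
  have q: "\<rho>' / \<rho> = q" "q * \<rho> = \<rho>'" "q * (\<rho> - 1) = 1" "q > 0"
    using assms(2,3) \<rho>'1 by (auto simp: q_def field_simps)
  have A0: "A > 0" using assms(2,4) \<rho>'1 by (simp add: A_def A_zero_def)
  have A_powr: "A powr \<rho> = \<gamma> * \<rho> / \<rho>'"
    using assms(2,4) \<rho>'1 by (simp add: A_def A_zero_def powr_powr)
  have L_t0: "L t0 > 1"
  proof -
    have "B_const TYPE('d) \<kappa> M > 0"
      unfolding B_const_def using assms(1)
      by (intro divide_pos_pos add_pos_nonneg sum_nonneg) auto
    then have "B_const TYPE('d) \<kappa> M powr \<rho> > 0" by simp
    then have "0 < B_const TYPE('d) \<kappa> M powr \<rho> / \<rho>" using assms(2) by (intro divide_pos_pos) auto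
    then have "1 / L t0 ^ ?d < 1" unfolding assms(14) by simp
    moreover have "L t0 \<ge> 1" using assms(11,13) by simp
    ultimately show ?thesis by (cases "L t0 = 1") auto
  qed
  have L_mono: "L t0 \<le> L t" if "t \<ge> t0" for t
    using assms(10,13) that by (auto simp: mono_on_def)
  have \<tau>_pos: "\<tau> t > 0" and \<tau>_powr: "\<tau> t powr \<rho>' = real ?d * \<rho>' / \<gamma> * ln (L t)" if "t \<ge> t0" for t
  proof -
    define b where "b = real ?d * \<rho>' / \<gamma> * ln (L t)"
    have "0 < b"
      unfolding b_def using L_t0 L_mono[OF that] assms(4) \<rho>'1 by (intro mult_pos_pos divide_pos_pos) auto
    then have "b powr (1 / \<rho>') > 0" "(b powr (1 / \<rho>')) powr \<rho>' = b"
      using \<rho>'1 by (simp_all add: powr_powr)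
    then show "\<tau> t > 0" "\<tau> t powr \<rho>' = real ?d * \<rho>' / \<gamma> * ln (L t)"
      by (simp_all add: \<tau>_def tau_def b_def)
  qed
  have \<tau>_mono: "\<tau> t0 \<le> \<tau> t" if "t \<ge> t0" for t
    unfolding \<tau>_def tau_def using L_t0 L_mono[OF that] assms(4) \<rho>'1
    by (intro powr_mono2 mult_left_mono) auto
  have x0: "x t0 > 0" using A0 \<tau>_pos[of t0] by (simp add: x_def)
  have x_mono: "x t0 \<le> x t" if "t \<ge> t0" for t
    unfolding x_def using A0 \<tau>_mono[OF that] \<tau>_pos[of t0] q by (intro mult_left_mono powr_mono2) auto
  have x_powr: "x t powr \<rho> / \<rho> = \<gamma> / \<rho>' * \<tau> t powr \<rho>'" if "t \<ge> t0" for t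
    using A0 A_powr \<tau>_pos[OF that] q assms(2) by (simp add: x_def powr_mult powr_powr)
  have level: "1 / L t ^ ?d = exp (- (x t powr \<rho> / \<rho>))" if "t \<ge> t0" for t
  proof -
    have "x t powr \<rho> / \<rho> = real ?d * ln (L t)"
      unfolding x_powr[OF that] \<tau>_powr[OF that] using assms(4) \<rho>'1 by simp
    moreover have "L t > 0" using L_t0 L_mono[OF that] by simp
    ultimately show ?thesis by (simp add: exp_minus exp_of_nat_mult inverse_eq_divide)
  qed
  have x_deriv: "x t powr (\<rho> - 1) = A powr (\<rho> - 1) * \<tau> t" if "t \<ge> t0" for t
    using A0 \<tau>_pos[OF that] q by (simp add: x_def powr_mult powr_powr)
  have x_power: "1 / x t ^ n = 1 / A ^ n * (1 / \<tau> t powr (real n * (\<rho>' / \<rho>)))" if "t \<ge> t0" for t n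
    using A0 \<tau>_pos[OF that] q by (simp add: x_def power_mult_distrib powr_powr mult.commute flip: powr_realpow)
  let ?h = "h_term \<mu> v \<kappa> \<rho> \<rho>' \<gamma> L"
  have sum_h: "(\<Sum>i=0..j. ?h i t) = F.chord_iterate j (x t)" if t: "t \<ge> t0" for j t
  proof (induction j)
    case 0
    show ?case unfolding F.chord_iterate.simps by (simp add: x_def A_def \<tau>_def q_def D_def)
  next
    case (Suc j)
    have "?h (Suc j) t = (1 / A powr (\<rho> - 1)) * (\<gamma> / \<rho>' * \<tau> t powr q + 1 / \<tau> t * ln (zeta \<mu> v \<kappa> \<rho> (Suc j) (F.chord_iterate j (x t))))"
      unfolding h_term.simps Suc by (simp add: A_def \<tau>_def q_def)
    also have "\<dots> = (\<gamma> / \<rho>' * \<tau> t powr \<rho>' - F.free_energy (Suc j) (F.chord_iterate j (x t))) / (A powr (\<rho> - 1) * \<tau> t)"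
    proof -
      have "\<tau> t powr \<rho>' = \<tau> t powr q * \<tau> t"
        using \<tau>_pos[OF t] by (simp add: q_def powr_diff)
      then show ?thesis using \<tau>_pos[OF t] A0 \<rho>'0 by (simp add: F.free_energy_def field_simps)
    qed
    finally show ?case using Suc by (simp add: x_powr[OF t] x_deriv[OF t])
  qed
  have h_Suc: "?h (Suc j) t = F.chord_iterate (Suc j) (x t) - F.chord_iterate j (x t)" if "t \<ge> t0" for j t
    using sum_h[OF that, of "Suc j"] sum_h[OF that, of j] by simp
  have expansion: "A * \<tau> t powr (\<rho>' - 1) - 2 * real ?d * \<kappa> + (\<Sum>j=1..M. ?h j t) = F.chord_iterate M (x t)" if "t \<ge> t0" for t
    using sum_h[OF that, of M] by (simp add: sum.atLeast_Suc_atMost A_def \<tau>_def)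
  have O_tau: "O_on {t0..} f (\<lambda>t. 1 / \<tau> t powr (real n * (\<rho>' / \<rho>)))"
    if "\<And>t. t \<ge> t0 \<Longrightarrow> \<bar>f t\<bar> \<le> C / x t ^ n" for f C n
    unfolding O_on_def
  proof (intro exI ballI)
    fix t assume "t \<in> {t0..}"
    then have t: "t \<ge> t0" by simp
    have eq: "C / x t ^ n = C / A ^ n * (1 / \<tau> t powr (real n * (\<rho>' / \<rho>)))"
      using x_power[OF t, of n] by (metis times_divide_eq_right mult.right_neutral mult.assoc)
    show "\<bar>f t\<bar> \<le> C / A ^ n * (1 / \<tau> t powr (real n * (\<rho>' / \<rho>)))"
      by (rule order_trans[OF that[OF t] eq_refl[OF eq]])
  qed
  have unique: "\<exists>!s. s \<ge> 0 \<and> zeta \<mu> v \<kappa> \<rho> M s = 1 / L t ^ ?d" if "t \<ge> t0" for t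
  proof (rule F.ex1_level)
    show "0 < 1 / L t ^ ?d" by (simp add: level[OF that])
    show "1 / L t ^ ?d \<le> zeta \<mu> v \<kappa> \<rho> M 0"
      unfolding F.zeta_0 assms(14)[symmetric]
      using L_t0 L_mono[OF that] by (intro divide_left_mono power_mono) auto
  qed
  have part1: "\<exists>!h. level_solution \<mu> v \<kappa> \<rho> \<rho>' L t0 h"
  proof (rule ex_ex1I)
    define h where "h = restrict (\<lambda>t. THE s. s \<ge> 0 \<and> zeta \<mu> v \<kappa> \<rho> M s = 1 / L t ^ ?d) {t0..}"
    have "h t \<ge> 0 \<and> zeta \<mu> v \<kappa> \<rho> M (h t) = 1 / L t ^ ?d" if "t \<ge> t0" for t
      using theI'[OF unique[OF that]] that by (simp add: h_def)
    then show "\<exists>h. level_solution \<mu> v \<kappa> \<rho> \<rho>' L t0 h"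
      by (intro exI[of _ h]) (auto simp: level_solution_def assms(12)[symmetric] PiE_iff h_def)
  next
    fix h h' assume h: "level_solution \<mu> v \<kappa> \<rho> \<rho>' L t0 h" "level_solution \<mu> v \<kappa> \<rho> \<rho>' L t0 h'"
    show "h = h'"
    proof (rule PiE_ext)
      show "h \<in> {t0..} \<rightarrow>\<^sub>E {0..}" "h' \<in> {t0..} \<rightarrow>\<^sub>E {0..}" using h by (simp_all add: level_solution_def)
      fix t assume "t \<in> {t0..}"
      then show "h t = h' t"
        using h unique[of t] unfolding level_solution_def assms(12)[symmetric] by (auto dest!: PiE_mem)
    qed
  qed
  have part2: "O_on {t0..} (\<lambda>t. h t - (A * \<tau> t powr (\<rho>' - 1) - 2 * real ?d * \<kappa> + (\<Sum>j=1..M. ?h j t)))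
      (\<lambda>t. 1 / \<tau> t powr ((2 * real M + 1) * (\<rho>' / \<rho>)))"
    if h: "level_solution \<mu> v \<kappa> \<rho> \<rho>' L t0 h" for h
  proof -
    obtain C where C: "\<And>y s. y \<ge> x t0 \<Longrightarrow> s \<ge> 0 \<Longrightarrow> zeta \<mu> v \<kappa> \<rho> M s = exp (- (y powr \<rho> / \<rho>)) \<Longrightarrow>
        \<bar>s - F.chord_iterate M y\<bar> \<le> C / y ^ (2 * M + 1)"
      using F.level_near_iterate[OF x0, of M] by blast
    have "O_on {t0..} (\<lambda>t. h t - (A * \<tau> t powr (\<rho>' - 1) - 2 * real ?d * \<kappa> + (\<Sum>j=1..M. ?h j t)))
      (\<lambda>t. 1 / \<tau> t powr (real (2 * M + 1) * (\<rho>' / \<rho>)))"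
    proof (rule O_tau)
      fix t assume t: "t \<ge> t0"
      show "\<bar>h t - (A * \<tau> t powr (\<rho>' - 1) - 2 * real ?d * \<kappa> + (\<Sum>j=1..M. ?h j t))\<bar> \<le> C / x t ^ (2 * M + 1)"
        unfolding expansion[OF t]
      proof (rule C[OF x_mono[OF t]])
        show "h t \<ge> 0" using h t by (auto simp: level_solution_def dest!: PiE_mem)
        show "zeta \<mu> v \<kappa> \<rho> M (h t) = exp (- (x t powr \<rho> / \<rho>))"
          using h t level[OF t] by (simp add: level_solution_def assms(12))
      qed
    qed
    then show ?thesis by (simp add: add.commute)
  qed
  have part3: "O_on {t0..} (?h j) (\<lambda>t. 1 / \<tau> t powr ((2 * real j - 1) * (\<rho>' / \<rho>)))" if le: "j \<in> {1..M}" for j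
  proof -
    obtain i where j: "j = Suc i" using le by (cases j) auto
    obtain C where C: "\<And>y. y \<ge> x t0 \<Longrightarrow> \<bar>F.chord_iterate (Suc i) y - F.chord_iterate i y\<bar> \<le> C / y ^ (2 * i + 1)"
      using F.chord_iterate_step_bound[OF x0, of i] by blast
    have "O_on {t0..} (?h j) (\<lambda>t. 1 / \<tau> t powr (real (2 * i + 1) * (\<rho>' / \<rho>)))"
    proof (rule O_tau)
      fix t assume t: "t \<ge> t0"
      show "\<bar>?h j t\<bar> \<le> C / x t ^ (2 * i + 1)"
        unfolding j h_Suc[OF t] by (rule C[OF x_mono[OF t]])
    qed
    then show ?thesis by (simp add: j add.commute)
  qed
  have exps: "(2 * real M + 1) * (\<rho>' / \<rho>) \<ge> 0" "\<And>j. j \<in> {1..M} \<Longrightarrow> (2 * real j - 1) * (\<rho>' / \<rho>) \<ge> 0"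
    using q(1,4) by auto
  show ?thesis
    unfolding A_def[symmetric] \<tau>_def[symmetric]
  proof (intro conjI allI ballI impI)
    show "\<exists>!h. level_solution \<mu> v \<kappa> \<rho> \<rho>' L t0 h" by (rule part1)
  next
    fix h assume h: "level_solution \<mu> v \<kappa> \<rho> \<rho>' L t0 h"
    show "O_on {t0..} (\<lambda>t. h t - (A * \<tau> t powr (\<rho>' - 1) - 2 * real ?d * \<kappa> + (\<Sum>j=1..M. ?h j t)))
      (\<lambda>t. 1 / \<tau> t powr ((2 * real M + 1) * (\<rho>' / \<rho>)))" by (rule part2[OF h])
    assume T: "O_on {t0..} (\<lambda>t. t) \<tau>"
    show "O_on ({t0..} \<inter> {0<..}) (\<lambda>t. h t - (A * \<tau> t powr (\<rho>' - 1) - 2 * real ?d * \<kappa> + (\<Sum>j=1..M. ?h j t)))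
      (\<lambda>t. 1 / t powr ((2 * real M + 1) * (\<rho>' / \<rho>)))"
      by (rule O_on_inverse_powr_comparison[OF T part2[OF h]]) (use \<tau>_pos exps in auto)
  next
    fix j assume j: "j \<in> {1..M}"
    show "O_on {t0..} (?h j) (\<lambda>t. 1 / \<tau> t powr ((2 * real j - 1) * (\<rho>' / \<rho>)))" by (rule part3[OF j])
    assume T: "O_on {t0..} (\<lambda>t. t) \<tau>"
    show "O_on ({t0..} \<inter> {0<..}) (?h j) (\<lambda>t. 1 / t powr ((2 * real j - 1) * (\<rho>' / \<rho>)))"
      by (rule O_on_inverse_powr_comparison[OF T part3[OF j]]) (use \<tau>_pos exps(2)[OF j] in auto)
  qed
qed

end
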